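(* Let $E$ be a finite set and let $\mathcal{C}^*$ be a set of signed sets (sign vectors) on the ground set $E$ satisfying: (C0) $\emptyset\notin\mathcal{C}^*$, where $\emptyset$ denotes the empty signed set $(\emptyset,\emptyset)$; (C1) $\mathcal{C}^*=-\mathcal{C}^*$; (C2) if $X,Y\in\mathcal{C}^*$ and $\underline{X}\subseteq\underline{Y}$, then $X=Y$ or $X=-Y$. Then the following are equivalent: (i) $\mathcal{C}^*$ is the set of cocircuits of an oriented matroid $\mathcal{M}$ on $E$. (ii) For every $k\geq 1$ and all $X_1,\ldots,X_k\in\mathcal{C}^*$, the crabbed hull $[X_1,\ldots,X_k]$, an induced subgraph of $G(\mathcal{C}^* )$, is $(h(X_1\circ\cdots\circ X_k)-1)$-connected. (iii) For all $X,Y\in\mathcal{C}^*$ with $X\neq\pm Y$ there is a crabbed $(X,Y)$-path in $G(\mathcal{C}^* )$.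
   Context: Signed sets. A signed set $X$ on a ground set $E$ is a pair $X=(X^+,X^-)$ of disjoint subsets of $E$. For $e\in E$ write $X(e)=+$ if $e\in X^+$, $X(e)=-$ if $e\in X^-$, and $X(e)=0$ otherwise. The support of $X$ is $\underline{X}:=X^+\cup X^-$. Put $-X:=(X^-,X^+)$, and $-\mathcal{C}^*:=\{-X\mid X\in\mathcal{C}^*\}$. The separator of signed sets $X,Y$ is $S(X,Y):=(X^+\cap Y^-)\cup(X^-\cap Y^+)$. Oriented matroid. A pair $\mathcal{M}=(E,\mathcal{C}^* )$ with $E$ finite is an oriented matroid with set of cocircuits $\mathcal{C}^*$ if $\mathcal{C}^*$ is a system of signed sets on $E$ satisfying the axioms (C0), (C1), (C2) written in the claim together with: (C3) for all $X,Y\in\mathcal{C}^*$ with $X\neq\pm Y$ and all $e\in S(X,Y)$ there exists $Z\in\mathcal{C}^*$ with $Z(e)=0$, $Z^+\subseteq X^+\cup Y^+$ and $Z^-\subseteq X^-\cup Y^-$. Composition and order. The composition of signed sets $X,Y$ is $X\circ Y:=(X^+\cup(Y^+\setminus X^-),\,X^-\cup(Y^-\setminus X^+))$ (an associative operation). Let $\mathcal{L}=\mathcal{L}(\mathcal{C}^* ):=\{X_1\circ\cdots\circ X_k\mid X_1,\ldots,X_k\in\mathcal{C}^*\}$ be the set of all finite compositions of elements of $\mathcal{C}^*$, including the empty composition $\emptyset=(\emptyset,\emptyset)$. Order $\mathcal{L}$ by: $Y\leq X$ if and only if $S(X,Y)=\emptyset$ and $\underline{Y}\subseteq\underline{X}$.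 Let $\hat{\mathcal{L}}:=\mathcal{L}\cup\{\hat 1\}$ be the poset obtained by adding a new global maximum $\hat 1$. For $U\in\mathcal{L}$, $h(U)$ denotes the rank (height) of $U$ in $(\hat{\mathcal{L}},\leq)$, i.e. the maximal length $m$ of a chain $\emptyset=U_0<U_1<\cdots<U_m=U$. (When $\mathcal{C}^*$ is the set of cocircuits of an oriented matroid, this poset is a graded lattice and $h$ is its rank function.) Graph. $G(\mathcal{C}^* )$ is the undirected simple graph with vertex set $\mathcal{C}^*$ in which two distinct $X,Y\in\mathcal{C}^*$ are adjacent if and only if there is $Z\in\hat{\mathcal{L}}$ such that $X$ and $Y$ are the only elements of $\mathcal{C}^*$ that are $\leq Z$. Crabbed hull and crabbed paths. For $X_1,\ldots,X_k\in\mathcal{C}^*$, the crabbed hull $[X_1,\ldots,X_k]$ is the subgraph of $G(\mathcal{C}^* )$ induced by $\{Z\in\mathcal{C}^*\mid Z(e)\in\{0,X_1(e),\ldots,X_k(e)\}\text{ for all }e\in E\}$. An $(X,Y)$-path in $G(\mathcal{C}^* )$, i.e. a path with end vertices $X$ and $Y$, is crabbed if it is contained in $[X,Y]$. Connectivity. A graph $G$ is $m$-connected ($m\geq 0$) if it has more than $m$ vertices and remains connected after deletion of any set of fewer than $m$ vertices; in particular every nonempty graph is $0$-connected, and the complete graph on $m+1$ vertices is $m$-connected. *)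

theory Defs
  imports "Graph_Theory.Graph_Theory"
begin

type_synonym 'a signed_set = "'a set \<times> 'a set"

abbreviation pos :: "'a signed_set \<Rightarrow> 'a set" where
  "pos X \<equiv> fst X"

abbreviation neg :: "'a signed_set \<Rightarrow> 'a set" where
  "neg X \<equiv> snd X"

definition signed_set_on :: "'a set \<Rightarrow> 'a signed_set \<Rightarrow> bool" where
  "signed_set_on E X \<longleftrightarrow> pos X \<inter> neg X = {} \<and> pos X \<subseteq> E \<and> neg X \<subseteq> E"

datatype sign = Plus | Minus | Zero

definition sign_at :: "'a signed_set \<Rightarrow> 'a \<Rightarrow> sign" where
  "sign_at X e = (if e \<in> pos X then Plus else if e \<in> neg X then Minus else Zero)"

definition empty_ss :: "'a signed_set" where
  "empty_ss = ({}, {})"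

definition opp :: "'a signed_set \<Rightarrow> 'a signed_set" where
  "opp X = (neg X, pos X)"

definition supp :: "'a signed_set \<Rightarrow> 'a set" where
  "supp X = pos X \<union> neg X"

definition separator :: "'a signed_set \<Rightarrow> 'a signed_set \<Rightarrow> 'a set" where
  "separator X Y = (pos X \<inter> neg Y) \<union> (neg X \<inter> pos Y)"

definition comp_ss :: "'a signed_set \<Rightarrow> 'a signed_set \<Rightarrow> 'a signed_set" where
  "comp_ss X Y = (pos X \<union> (pos Y - neg X), neg X \<union> (neg Y - pos X))"

definition comp_list :: "'a signed_set list \<Rightarrow> 'a signed_set" where
  "comp_list Xs = foldr comp_ss Xs empty_ss"

definition le_ss :: "'a signed_set \<Rightarrow> 'a signed_set \<Rightarrow> bool" where
  "le_ss Y X \<longleftrightarrow> separator X Y = {} \<and> supp Y \<subseteq> supp X"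

definition oriented_matroid :: "'a set \<Rightarrow> 'a signed_set set \<Rightarrow> bool" where
  "oriented_matroid E C \<longleftrightarrow>
     finite E \<and>
     (\<forall>X\<in>C. signed_set_on E X) \<and>
     empty_ss \<notin> C \<and>
     C = opp ` C \<and>
     (\<forall>X\<in>C. \<forall>Y\<in>C. supp X \<subseteq> supp Y \<longrightarrow> X = Y \<or> X = opp Y) \<and>
     (\<forall>X\<in>C. \<forall>Y\<in>C. X \<noteq> Y \<and> X \<noteq> opp Y \<longrightarrow>
        (\<forall>e\<in>separator X Y. \<exists>Z\<in>C. sign_at Z e = Zero \<and>
           pos Z \<subseteq> pos X \<union> pos Y \<and> neg Z \<subseteq> neg X \<union> neg Y))"

definition covectors :: "'a signed_set set \<Rightarrow> 'a signed_set set" where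
  "covectors C = {comp_list Xs | Xs. set Xs \<subseteq> C}"

datatype 'b with_top = Elem 'b | Top

definition covectors_top :: "'a signed_set set \<Rightarrow> 'a signed_set with_top set" where
  "covectors_top C = insert Top (Elem ` covectors C)"

fun le_top :: "'a signed_set with_top \<Rightarrow> 'a signed_set with_top \<Rightarrow> bool" where
  "le_top _ Top \<longleftrightarrow> True"
| "le_top Top (Elem _) \<longleftrightarrow> False"
| "le_top (Elem Y) (Elem X) \<longleftrightarrow> le_ss Y X"

definition lt_top :: "'a signed_set with_top \<Rightarrow> 'a signed_set with_top \<Rightarrow> bool" where
  "lt_top Y X \<longleftrightarrow> le_top Y X \<and> Y \<noteq> X"

text \<open>The set of chain lengths below is finite and nonempty whenever \<open>C\<close> consists of
  signed sets on a finite ground set and \<open>U\<close> is a covector.\<close>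

definition height :: "'a signed_set set \<Rightarrow> 'a signed_set \<Rightarrow> nat" where
  "height C U = Max {m. \<exists>c :: nat \<Rightarrow> 'a signed_set with_top.
     c 0 = Elem empty_ss \<and> c m = Elem U \<and>
     (\<forall>i\<le>m. c i \<in> covectors_top C) \<and> (\<forall>i<m. lt_top (c i) (c (Suc i)))}"

text \<open>Undirected simple graphs are symmetric loop-free digraphs whose arcs are pairs of
  vertices.\<close>

type_synonym 'v simple_graph = "('v, 'v \<times> 'v) pre_digraph"

definition cocircuit_adj :: "'a signed_set set \<Rightarrow> 'a signed_set \<Rightarrow> 'a signed_set \<Rightarrow> bool" where
  "cocircuit_adj C X Y \<longleftrightarrow> X \<in> C \<and> Y \<in> C \<and> X \<noteq> Y \<and>
     (\<exists>Z\<in>covectors_top C. {W \<in> C. le_top (Elem W) Z} = {X, Y})"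

definition cocircuit_graph :: "'a signed_set set \<Rightarrow> 'a signed_set simple_graph" where
  "cocircuit_graph C = with_proj \<lparr> pverts = C, parcs = {(X, Y). cocircuit_adj C X Y} \<rparr>"

lemma cocircuit_adj_sym: "cocircuit_adj C X Y \<Longrightarrow> cocircuit_adj C Y X"
  unfolding cocircuit_adj_def insert_commute[of X Y "{}"] by blast

lemma graph_cocircuit_graph:
  assumes "finite C"
  shows "graph (cocircuit_graph C)"
proof -
  define G where "G = \<lparr> pverts = C, parcs = {(X, Y). cocircuit_adj C X Y} \<rparr>"
  have V: "pverts G = C" and A: "parcs G = {(X, Y). cocircuit_adj C X Y}"
    by (simp_all add: G_def)
  have sub: "parcs G \<subseteq> C \<times> C"
    unfolding A cocircuit_adj_def by blast
  have "pair_graph G"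
  proof
    show "finite (pverts G)" using assms V by simp
    show "finite (parcs G)" using finite_subset[OF sub] assms by simp
    show "symmetric (with_proj G)"
      unfolding symmetric_def with_proj_simps A sym_def using cocircuit_adj_sym by blast
    show "fst e \<in> pverts G" "snd e \<in> pverts G" if "e \<in> parcs G" for e
      using sub that V by auto
    show "fst e \<noteq> snd e" if "e \<in> parcs G" for e
      using that unfolding A cocircuit_adj_def by (cases e) simp
  qed
  then show ?thesis
    unfolding cocircuit_graph_def G_def by (rule pair_graph.pair_graphD_graph)
qed

text \<open>Quantifying over all elements \<open>e\<close> is the same as quantifying over the ground set,
  since every cocircuit has sign \<open>Zero\<close> outside it.\<close>

definition crabbed_hull :: "'a signed_set set \<Rightarrow> 'a signed_set list \<Rightarrow> 'a signed_set simple_graph" where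
  "crabbed_hull C Xs = cocircuit_graph C \<restriction>
     {Z \<in> C. \<forall>e. sign_at Z e \<in> insert Zero ((\<lambda>X. sign_at X e) ` set Xs)}"

definition crabbed_path ::
    "'a signed_set set \<Rightarrow> 'a signed_set \<Rightarrow> ('a signed_set \<times> 'a signed_set) awalk \<Rightarrow> 'a signed_set \<Rightarrow> bool" where
  "crabbed_path C X p Y \<longleftrightarrow>
     pre_digraph.apath (cocircuit_graph C) X p Y \<and>
     set (pre_digraph.awalk_verts (cocircuit_graph C) X p) \<subseteq> verts (crabbed_hull C [X, Y]) \<and>
     set p \<subseteq> arcs (crabbed_hull C [X, Y])"

text \<open>Only finite graphs are intended; \<open>finite\<close> also keeps \<open>card\<close> meaningful.\<close>

definition m_connected :: "nat \<Rightarrow> 'v simple_graph \<Rightarrow> bool" where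
  "m_connected m G \<longleftrightarrow>
     finite (verts G) \<and> card (verts G) > m \<and>
     (\<forall>S \<subseteq> verts G. card S < m \<longrightarrow> Digraph_Component.connected (G \<restriction> (verts G - S)))"

end

theory Submission
  imports Defs
begin

text \<open>A crabbed path from \<open>X\<close> to \<open>Y\<close> cannot jump from sign \<open>X(e)\<close> to sign \<open>Y(e)\<close> along an edge,
  since adjacent cocircuits conform to a common covector; hence it meets a vertex vanishing at \<open>e\<close>,
  which is what cocircuit elimination asks for.

  Conversely, weak elimination is upgraded first to elimination that keeps a prescribed element and
  then to covector elimination. Let \<open>v\<close> be a vertex of the face \<open>T\<close>. The faces of \<open>T\<close> not containing \<open>v\<close>
  are connected under inclusion: relax the sign constraints on the support of \<open>v\<close> one at a time, and
  replace an excursion of a path to the wrong side of \<open>g\<close> by a path in the face where \<open>g\<close> vanishes.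
  So the vertices of \<open>T\<close> other than \<open>v\<close> are connected within \<open>T\<close>. Crabbed hulls are then connected by
  induction on the separator, and for higher connectivity a deleted vertex \<open>v\<close> on a path is bypassed
  inside the faces around it, by induction on the rank.\<close>

section \<open>Sign vectors\<close>

text \<open>Looking at the faces around a vertex \<open>v\<close> leads to another oriented matroid,
  so everything after cocircuit elimination is proved for abstract sets of covectors
  (\<open>covector_system\<close>), and crabbed hulls are generalised to cones, given by a set
  \<open>A e\<close> of allowed signs at each \<open>e\<close>. Cones are closed under composition,
  under passing to faces and under \<open>away v\<close>. To get the bound h(X_1 o ... o X_k) - 1,
  the covectors are first restricted to those supported inside the support of this composition: it
  then has full support, and a longest chain below it bounds the rank from below. Two obstacles
  shape the induction. A deleted vertex may turn into the interior of an edge around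
  \<open>v\<close>, so the smaller graph loses edges as well as vertices;
  \<open>mixed_deletion\<close> trades each lost edge for a lost end. And elimination between
  opposite vertices x and -x may produce zero, so these are joined through a third vertex, which
  exists from rank 2 on. From (ii) to (iii) it suffices that h(X o Y) is at least 2 when X is
  neither Y nor -Y.\<close>

fun flip :: "sign \<Rightarrow> sign" where
  "flip Plus = Minus" | "flip Minus = Plus" | "flip Zero = Zero"

lemma flip_flip [simp]: "flip (flip s) = s"
  by (cases s) auto

lemma flip_eq_Zero [simp]: "flip s = Zero \<longleftrightarrow> s = Zero" "Zero = flip s \<longleftrightarrow> s = Zero"
  by (cases s; simp)+

lemma flip_eq_self [simp]: "flip s = s \<longleftrightarrow> s = Zero" "s = flip s \<longleftrightarrow> s = Zero"
  by (cases s; simp)+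

lemma sign_cases2: "s = Zero \<or> t = Zero \<or> s = t \<or> t = flip s"
  by (cases s; cases t; simp)

definition sneg :: "('a \<Rightarrow> sign) \<Rightarrow> 'a \<Rightarrow> sign" where
  "sneg X = (\<lambda>e. flip (X e))"

definition scirc :: "('a \<Rightarrow> sign) \<Rightarrow> ('a \<Rightarrow> sign) \<Rightarrow> 'a \<Rightarrow> sign" where
  "scirc X Y = (\<lambda>e. if X e = Zero then Y e else X e)"

definition szero :: "'a \<Rightarrow> sign" where
  "szero = (\<lambda>_. Zero)"

definition sle :: "('a \<Rightarrow> sign) \<Rightarrow> ('a \<Rightarrow> sign) \<Rightarrow> bool" where
  "sle X Y \<longleftrightarrow> (\<forall>e. X e = Zero \<or> X e = Y e)"

definition ssupp :: "('a \<Rightarrow> sign) \<Rightarrow> 'a set" where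
  "ssupp X = {e. X e \<noteq> Zero}"

definition ssep :: "('a \<Rightarrow> sign) \<Rightarrow> ('a \<Rightarrow> sign) \<Rightarrow> 'a set" where
  "ssep X Y = {e. X e \<noteq> Zero \<and> Y e = flip (X e)}"

lemma sneg_apply [simp]: "sneg X e = flip (X e)"
  by (simp add: sneg_def)

lemma szero_apply [simp]: "szero e = Zero"
  by (simp add: szero_def)

lemma scirc_apply: "scirc X Y e = (if X e = Zero then Y e else X e)"
  by (simp add: scirc_def)

lemma mem_ssupp [simp]: "e \<in> ssupp X \<longleftrightarrow> X e \<noteq> Zero"
  by (simp add: ssupp_def)

lemma mem_ssep: "e \<in> ssep X Y \<longleftrightarrow> X e \<noteq> Zero \<and> Y e = flip (X e)"
  by (simp add: ssep_def)

lemma ssep_commute: "ssep X Y = ssep Y X"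
  by (auto simp: ssep_def)

lemma sneg_sneg [simp]: "sneg (sneg X) = X"
  by (simp add: sneg_def)

lemma sle_refl [simp]: "sle X X"
  by (simp add: sle_def)

lemma sle_trans: "sle X Y \<Longrightarrow> sle Y Z \<Longrightarrow> sle X Z"
  unfolding sle_def by metis

lemma sle_antisym: "sle X Y \<Longrightarrow> sle Y X \<Longrightarrow> X = Y"
  unfolding sle_def by (rule ext) metis

lemma sle_scirc [simp]: "sle X (scirc X Y)"
  by (simp add: sle_def scirc_apply)

lemma sle_ssupp: "sle X Y \<Longrightarrow> ssupp X \<subseteq> ssupp Y"
  unfolding sle_def by (metis mem_ssupp subsetI)

lemma sle_ssupp_eq: "sle X Y \<Longrightarrow> ssupp Y \<subseteq> ssupp X \<Longrightarrow> X = Y"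
  unfolding sle_def by (rule ext) (metis mem_ssupp subsetD)

lemma sle_ssupp_psubset: "sle X Y \<Longrightarrow> X \<noteq> Y \<Longrightarrow> ssupp X \<subset> ssupp Y"
  using sle_ssupp_eq sle_ssupp by (metis psubsetI subset_refl)

lemma nonzero_ex: "X \<noteq> szero \<longleftrightarrow> (\<exists>e. X e \<noteq> Zero)"
  by (auto simp: szero_def fun_eq_iff)

lemma scirc_least: "sle X Z \<Longrightarrow> sle Y Z \<Longrightarrow> sle (scirc X Y) Z"
  by (auto simp: sle_def scirc_apply)

lemma scirc_conformal_ge: "ssep X Y = {} \<Longrightarrow> sle Y (scirc X Y)"
proof -
  assume *: "ssep X Y = {}"
  have "Y e = Zero \<or> Y e = scirc X Y e" for e
    using * sign_cases2[of "X e" "Y e"] by (auto simp: scirc_apply ssep_def)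
  then show "sle Y (scirc X Y)" by (simp add: sle_def)
qed

lemma sle_iff_ssep: "sle Y X \<longleftrightarrow> ssep X Y = {} \<and> ssupp Y \<subseteq> ssupp X"
proof
  assume le: "sle Y X"
  have "e \<notin> ssep X Y" for e using le unfolding sle_def mem_ssep by (metis flip_eq_Zero(1) flip_eq_self(2))
  then show "ssep X Y = {} \<and> ssupp Y \<subseteq> ssupp X" using sle_ssupp[OF le] by blast
next
  assume *: "ssep X Y = {} \<and> ssupp Y \<subseteq> ssupp X"
  have "Y e = Zero \<or> Y e = X e" for e
  proof -
    have "e \<notin> ssep X Y" "Y e = Zero \<or> X e \<noteq> Zero" using * by auto
    then show ?thesis using sign_cases2[of "X e" "Y e"] unfolding mem_ssep by metis
  qed
  then show "sle Y X" by (simp add: sle_def)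
qed

lemma ssep_conformal: "sle x T \<Longrightarrow> sle y T \<Longrightarrow> ssep x y = {}"
proof (rule ccontr)
  assume *: "sle x T" "sle y T" "ssep x y \<noteq> {}"
  then obtain e where e: "x e \<noteq> Zero" "y e = flip (x e)" by (auto simp: ssep_def)
  then have "x e = T e" "y e = T e" using *(1,2) unfolding sle_def by (metis flip_eq_Zero(1))+
  then show False using e by (metis flip_eq_self(1))
qed

section \<open>From cocircuit elimination to covector elimination\<close>

text \<open>Axioms (C0) to (C3) for sign functions. In \<open>weak\<close> the case X = Y is
  excluded by the nonempty separator, and the condition on \<open>Z h\<close> merges the two
  inclusions of (C3).\<close>

locale weak_cocircuits =
  fixes E :: "'a set" and C :: "('a \<Rightarrow> sign) set"
  assumes fin: "finite E"
    and supp: "X \<in> C \<Longrightarrow> ssupp X \<subseteq> E"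
    and nonzero: "szero \<notin> C"
    and neg: "X \<in> C \<Longrightarrow> sneg X \<in> C"
    and incomp: "X \<in> C \<Longrightarrow> Y \<in> C \<Longrightarrow> ssupp X \<subseteq> ssupp Y \<Longrightarrow> X = Y \<or> X = sneg Y"
    and weak: "X \<in> C \<Longrightarrow> Y \<in> C \<Longrightarrow> X \<noteq> sneg Y \<Longrightarrow> e \<in> ssep X Y \<Longrightarrow>
      \<exists>Z\<in>C. Z e = Zero \<and> (\<forall>h. Z h \<in> {Zero, X h, Y h})"
begin

lemma finite_ssupp: "X \<in> C \<Longrightarrow> finite (ssupp X)"
  using fin supp finite_subset by blast

text \<open>The wrong signs of \<open>V\<close> are opposite to those of \<open>Z\<close>, so they can be eliminated between \<open>V\<close>
  and \<open>Z\<close>; this keeps \<open>f\<close>, where \<open>Z\<close> vanishes.\<close>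

lemma repair_signs:
  assumes Z: "Z \<in> C" "Z f = Zero" "\<forall>h. Z h \<in> {Zero, X h, Y h}"
    and V: "V \<in> C" "V f \<noteq> Zero" "V e = Zero" "Z e = Zero"
    and bad: "\<forall>h. V h \<in> {Zero, X h, Y h} \<or> V h = flip (Z h)"
    and elim: "\<And>V h. V \<in> C \<Longrightarrow> V e = Zero \<Longrightarrow> V f \<noteq> Zero \<Longrightarrow> h \<in> ssep V Z \<Longrightarrow>
        ssupp V \<subseteq> ssupp X \<union> ssupp Y \<Longrightarrow>
        \<exists>W\<in>C. W h = Zero \<and> W f = V f \<and> (\<forall>k. W k \<in> {Zero, V k, Z k})"
  shows "\<exists>W\<in>C. W e = Zero \<and> W f = V f \<and> (\<forall>h. W h \<in> {Zero, X h, Y h})"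
  using V bad
proof (induction "card {h. V h \<notin> {Zero, X h, Y h}}" arbitrary: V rule: less_induct)
  case less
  let ?B = "{h. V h \<notin> {Zero, X h, Y h}}"
  show ?case
  proof (cases "?B = {}")
    case True
    then show ?thesis using less.prems by blast
  next
    case False
    then obtain h where h: "V h \<notin> {Zero, X h, Y h}" by blast
    then have "V h = flip (Z h)" "V h \<noteq> Zero" using less.prems by auto
    then have hs: "h \<in> ssep V Z" by (simp add: mem_ssep)
    have "ssupp V \<subseteq> ssupp X \<union> ssupp Y"
    proof
      fix k assume "k \<in> ssupp V"
      moreover have "Z k \<in> {Zero, X k, Y k}" using Z by blast
      moreover have "V k \<in> {Zero, X k, Y k} \<or> V k = flip (Z k)" using less.prems by blast
      ultimately show "k \<in> ssupp X \<union> ssupp Y" by auto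
    qed
    then obtain W where W: "W \<in> C" "W h = Zero" "W f = V f" "\<forall>k. W k \<in> {Zero, V k, Z k}"
      using elim[OF less.prems(1) less.prems(3) less.prems(2) hs] by blast
    have We: "W e = Zero" using W(4) less.prems by (metis empty_iff insert_iff)
    have sub: "{k. W k \<notin> {Zero, X k, Y k}} \<subseteq> ?B - {h}"
    proof
      fix k assume "k \<in> {k. W k \<notin> {Zero, X k, Y k}}"
      moreover have "W k \<in> {Zero, V k, Z k}" "Z k \<in> {Zero, X k, Y k}" using W Z(3) by blast+
      ultimately show "k \<in> ?B - {h}" using W(2) by auto
    qed
    have "?B \<subseteq> ssupp V" by auto
    then have "finite ?B" using finite_ssupp less.prems(1) finite_subset by blast
    then have "card {k. W k \<notin> {Zero, X k, Y k}} < card ?B"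
      using sub h by (intro psubset_card_mono) auto
    moreover have "\<forall>k. W k \<in> {Zero, X k, Y k} \<or> W k = flip (Z k)"
    proof
      fix k
      have "W k \<in> {Zero, V k, Z k}" "Z k \<in> {Zero, X k, Y k}"
        "V k \<in> {Zero, X k, Y k} \<or> V k = flip (Z k)" using W Z(3) less.prems(5) by blast+
      then show "W k \<in> {Zero, X k, Y k} \<or> W k = flip (Z k)" by auto
    qed
    ultimately have "\<exists>W'\<in>C. W' e = Zero \<and> W' f = W f \<and> (\<forall>h. W' h \<in> {Zero, X h, Y h})"
      using less.hyps[of W] W We less.prems by metis
    then show ?thesis using W(3) by simp
  qed
qed

text \<open>If weak elimination loses \<open>f\<close>, its result \<open>Z\<close> is used as a
  tool: with \<open>g\<close> in \<open>Z\<close> but not in \<open>X\<close>, eliminating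
  \<open>g\<close> between \<open>Y\<close> and \<open>sneg Z\<close> gives \<open>Y1\<close> with
  the old sign at \<open>e\<close>; eliminating \<open>e\<close> between \<open>X\<close> and
  \<open>Y1\<close> keeps \<open>f\<close>, and wrong signs are repaired with \<open>Z\<close>. The
  three recursive calls miss \<open>f\<close>, \<open>g\<close> and \<open>e\<close> respectively,
  so the union of supports shrinks each time.\<close>

lemma elim_keep_unshared:
  assumes "X \<in> C" "Y \<in> C" "e \<in> ssep X Y" "X f \<noteq> Zero" "Y f = Zero"
  shows "\<exists>Z\<in>C. Z e = Zero \<and> Z f = X f \<and> (\<forall>h. Z h \<in> {Zero, X h, Y h})"
  using assms
proof (induction "card (ssupp X \<union> ssupp Y)" arbitrary: X Y e f rule: less_induct)
  case less
  have finXY: "finite (ssupp X \<union> ssupp Y)" using less.prems finite_ssupp by blast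
  have ne: "X \<noteq> sneg Y" using less.prems by auto
  have Xe: "X e \<noteq> Zero" "Y e = flip (X e)" using less.prems by (auto simp: mem_ssep)
  obtain Z where Z: "Z \<in> C" "Z e = Zero" "\<forall>h. Z h \<in> {Zero, X h, Y h}"
    using weak[OF less.prems(1,2) ne less.prems(3)] by blast
  show ?case
  proof (cases "Z f = Zero")
    case False
    then show ?thesis using Z less.prems by (metis empty_iff insert_iff)
  next
    case Zf: True
    \<comment> \<open>Otherwise \<open>Z\<close> would be \<open>X\<close> or \<open>sneg X\<close>
      by incomparability, although \<open>Z\<close> vanishes at \<open>e\<close> and
      \<open>X\<close> does not.\<close>
    have "\<not> ssupp Z \<subseteq> ssupp X"
      using incomp[OF Z(1) less.prems(1)] Z(2) Xe by auto
    then obtain g where g: "Z g \<noteq> Zero" "X g = Zero" by auto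
    then have Yg: "Y g = Z g" using Z(3) by (metis empty_iff insert_iff)
    have supZ: "ssupp Z \<subseteq> ssupp X \<union> ssupp Y"
    proof
      fix k assume "k \<in> ssupp Z"
      moreover have "Z k \<in> {Zero, X k, Y k}" using Z by blast
      ultimately show "k \<in> ssupp X \<union> ssupp Y" by auto
    qed
    have "card (ssupp Y \<union> ssupp (sneg Z)) < card (ssupp X \<union> ssupp Y)"
    proof (rule psubset_card_mono[OF finXY])
      have "f \<notin> ssupp Y \<union> ssupp (sneg Z)" "f \<in> ssupp X \<union> ssupp Y"
        using less.prems Zf by auto
      moreover have "ssupp Y \<union> ssupp (sneg Z) \<subseteq> ssupp X \<union> ssupp Y" using supZ by auto
      ultimately show "ssupp Y \<union> ssupp (sneg Z) \<subset> ssupp X \<union> ssupp Y" by blast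
    qed
    then obtain Y1 where Y1: "Y1 \<in> C" "Y1 g = Zero" "Y1 e = Y e"
        "\<forall>h. Y1 h \<in> {Zero, Y h, flip (Z h)}"
      using less.hyps[of Y "sneg Z" g e] less.prems(2) neg[OF Z(1)] Yg g Xe Z(2)
      by (auto simp: mem_ssep)
    have Y1f: "Y1 f = Zero" using Y1(4) less.prems(5) Zf by (metis empty_iff flip.simps(3) insert_iff)
    have supY1: "ssupp Y1 \<subseteq> ssupp X \<union> ssupp Y"
    proof
      fix k assume "k \<in> ssupp Y1"
      moreover have "Y1 k \<in> {Zero, Y k, flip (Z k)}" using Y1 by blast
      ultimately have "k \<in> ssupp Y \<or> k \<in> ssupp Z" by auto
      then show "k \<in> ssupp X \<union> ssupp Y" using supZ by blast
    qed
    have "card (ssupp X \<union> ssupp Y1) < card (ssupp X \<union> ssupp Y)"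
    proof (rule psubset_card_mono[OF finXY])
      have "g \<notin> ssupp X \<union> ssupp Y1" "g \<in> ssupp X \<union> ssupp Y"
        using g Y1 Yg by auto
      then show "ssupp X \<union> ssupp Y1 \<subset> ssupp X \<union> ssupp Y" using supY1 by blast
    qed
    then obtain V where V: "V \<in> C" "V e = Zero" "V f = X f" "\<forall>h. V h \<in> {Zero, X h, Y1 h}"
      using less.hyps[of X Y1 e f] less.prems Y1 Y1f by (auto simp: mem_ssep)
    have bad: "\<forall>h. V h \<in> {Zero, X h, Y h} \<or> V h = flip (Z h)"
      using V(4) Y1(4) by (metis insert_iff singletonD)
    have "\<exists>W\<in>C. W e = Zero \<and> W f = V f \<and> (\<forall>h. W h \<in> {Zero, X h, Y h})"
    proof (rule repair_signs[OF Z(1) Zf Z(3) V(1) _ V(2) Z(2) bad])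
      show "V f \<noteq> Zero" using V less.prems by simp
    next
      fix V h
      assume V: "V \<in> C" "V e = Zero" "V f \<noteq> Zero" "h \<in> ssep V Z" "ssupp V \<subseteq> ssupp X \<union> ssupp Y"
      have "card (ssupp V \<union> ssupp Z) < card (ssupp X \<union> ssupp Y)"
      proof (rule psubset_card_mono[OF finXY])
        have "e \<notin> ssupp V \<union> ssupp Z" "e \<in> ssupp X \<union> ssupp Y"
          using V Z Xe by auto
        then show "ssupp V \<union> ssupp Z \<subset> ssupp X \<union> ssupp Y" using supZ V(5) by blast
      qed
      then show "\<exists>W\<in>C. W h = Zero \<and> W f = V f \<and> (\<forall>k. W k \<in> {Zero, V k, Z k})"
        using less.hyps[of V Z h f] V Z(1) Zf by blast
    qed
    then show ?thesis using V(3) by simp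
  qed
qed

text \<open>Same scheme as for an element outside \<open>Y\<close>, now allowing \<open>X\<close>
  and \<open>Y\<close> to share the sign at \<open>f\<close>. Only the elimination between
  \<open>X\<close> and \<open>Y1\<close> is recursive; the other two keep an element where one
  partner vanishes (\<open>e\<close> for \<open>sneg Z\<close>, \<open>f\<close> for
  \<open>Z\<close>), so the unshared version applies.\<close>

lemma elim_keep:
  assumes "X \<in> C" "Y \<in> C" "e \<in> ssep X Y" "X f \<noteq> Zero" "f \<notin> ssep X Y"
  shows "\<exists>Z\<in>C. Z e = Zero \<and> Z f = X f \<and> (\<forall>h. Z h \<in> {Zero, X h, Y h})"
  using assms
proof (induction "card (ssupp X \<union> ssupp Y)" arbitrary: Y rule: less_induct)
  case less
  have Yf: "Y f = Zero \<or> Y f = X f"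
    using less.prems sign_cases2[of "X f" "Y f"] by (auto simp: mem_ssep)
  have finXY: "finite (ssupp X \<union> ssupp Y)" using less.prems finite_ssupp by blast
  have ne: "X \<noteq> sneg Y"
  proof
    assume "X = sneg Y"
    then have "X f = flip (Y f)" by simp
    then show False using Yf less.prems(4) by auto
  qed
  have Xe: "X e \<noteq> Zero" "Y e = flip (X e)" using less.prems by (auto simp: mem_ssep)
  obtain Z where Z: "Z \<in> C" "Z e = Zero" "\<forall>h. Z h \<in> {Zero, X h, Y h}"
    using weak[OF less.prems(1,2) ne less.prems(3)] by blast
  show ?case
  proof (cases "Z f = Zero")
    case False
    then show ?thesis using Z Yf by (metis empty_iff insert_iff)
  next
    case Zf: True
    have "\<not> ssupp Z \<subseteq> ssupp X"
      using incomp[OF Z(1) less.prems(1)] Z(2) Xe by auto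
    then obtain g where g: "Z g \<noteq> Zero" "X g = Zero" by auto
    then have Yg: "Y g = Z g" using Z(3) by (metis empty_iff insert_iff)
    obtain Y1 where Y1: "Y1 \<in> C" "Y1 g = Zero" "Y1 e = Y e"
        "\<forall>h. Y1 h \<in> {Zero, Y h, flip (Z h)}"
      using elim_keep_unshared[of Y "sneg Z" g e] less.prems(2) neg[OF Z(1)] Yg g Xe Z(2)
      by (auto simp: mem_ssep)
    have "Y1 f = Zero \<or> Y1 f = X f" using Y1(4) Yf Zf by (metis empty_iff flip.simps(3) insert_iff)
    then have Y1f: "f \<notin> ssep X Y1" using less.prems by (auto simp: mem_ssep)
    have "card (ssupp X \<union> ssupp Y1) < card (ssupp X \<union> ssupp Y)"
    proof (rule psubset_card_mono[OF finXY])
      have "g \<notin> ssupp X \<union> ssupp Y1" "g \<in> ssupp X \<union> ssupp Y"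
        using g Y1 Yg by auto
      moreover have "ssupp Y1 \<subseteq> ssupp X \<union> ssupp Y"
      proof
        fix k assume "k \<in> ssupp Y1"
        moreover have "Y1 k \<in> {Zero, Y k, flip (Z k)}" "Z k \<in> {Zero, X k, Y k}"
          using Y1 Z by blast+
        ultimately show "k \<in> ssupp X \<union> ssupp Y" by auto
      qed
      ultimately show "ssupp X \<union> ssupp Y1 \<subset> ssupp X \<union> ssupp Y" by blast
    qed
    then obtain V where V: "V \<in> C" "V e = Zero" "V f = X f" "\<forall>h. V h \<in> {Zero, X h, Y1 h}"
      using less.hyps[of Y1] less.prems Y1 Y1f by (auto simp: mem_ssep)
    have bad: "\<forall>h. V h \<in> {Zero, X h, Y h} \<or> V h = flip (Z h)"
      using V(4) Y1(4) by (metis insert_iff singletonD)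
    have "\<exists>W\<in>C. W e = Zero \<and> W f = V f \<and> (\<forall>h. W h \<in> {Zero, X h, Y h})"
    proof (rule repair_signs[OF Z(1) Zf Z(3) V(1) _ V(2) Z(2) bad])
      show "V f \<noteq> Zero" using V less.prems by simp
    next
      fix V h
      assume "V \<in> C" "V f \<noteq> Zero" "h \<in> ssep V Z"
      then show "\<exists>W\<in>C. W h = Zero \<and> W f = V f \<and> (\<forall>k. W k \<in> {Zero, V k, Z k})"
        using elim_keep_unshared Z(1) Zf by blast
    qed
    then show ?thesis using V(3) by simp
  qed
qed

section \<open>Compositions of cocircuits satisfy the covector axioms\<close>

inductive_set compositions :: "('a \<Rightarrow> sign) set" where
  zero: "szero \<in> compositions"
| snoc: "P \<in> compositions \<Longrightarrow> X \<in> C \<Longrightarrow> scirc P X \<in> compositions"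

text \<open>Conformal decomposition: a composition is covered by cocircuits below it. Appending a
  factor on the right suits the induction, since a new nonzero coordinate \<open>e\<close> of
  \<open>scirc P X\<close> must come from \<open>X\<close>.\<close>

lemma conformal_below:
  assumes "P \<in> compositions" "P e \<noteq> Zero"
  shows "\<exists>Z\<in>C. sle Z P \<and> Z e \<noteq> Zero"
  using assms
proof (induction arbitrary: e)
  case zero
  then show ?case by simp
next
  case (snoc P X)
  show ?case
  proof (cases "P e = Zero")
    case False
    then show ?thesis using snoc.IH sle_trans sle_scirc by meson
  next
    case Pe: True
    \<comment> \<open>Starting from \<open>X\<close>, conflicts with \<open>P\<close> are removed
      one at a time by elimination against a cocircuit below \<open>P\<close>. As
      \<open>P e = Zero\<close>, that cocircuit vanishes at \<open>e\<close>, so the sign at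
      \<open>e\<close> can be kept.\<close>
    have "\<exists>Z'\<in>C. sle Z' (scirc P X) \<and> Z' e \<noteq> Zero"
      if "Z \<in> C" "Z e \<noteq> Zero" "\<forall>h. P h \<noteq> Zero \<or> Z h \<in> {Zero, X h}" for Z
      using that
    proof (induction "card (ssep P Z)" arbitrary: Z rule: less_induct)
      case less
      show ?case
      proof (cases "ssep P Z = {}")
        case True
        have "sle Z (scirc P X)"
          unfolding sle_def
        proof
          fix h show "Z h = Zero \<or> Z h = scirc P X h"
            using True less.prems(3) sign_cases2[of "P h" "Z h"]
            by (auto simp: scirc_apply ssep_def)
        qed
        then show ?thesis using less.prems by blast
      next
        case False
        then obtain g where g: "g \<in> ssep P Z" by blast
        then have "P g \<noteq> Zero" by (simp add: mem_ssep)
        then obtain P1 where P1: "P1 \<in> C" "sle P1 P" "P1 g \<noteq> Zero" using snoc.IH by blast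
        have "P1 e = Zero" "P1 g = P g" using P1 Pe by (metis sle_def)+
        then obtain W where W: "W \<in> C" "W g = Zero" "W e = Z e" "\<forall>h. W h \<in> {Zero, Z h, P1 h}"
          using elim_keep_unshared[of Z P1 g e] less.prems P1 g by (auto simp: mem_ssep)
        have "ssep P W \<subseteq> ssep P Z - {g}"
        proof
          fix h assume "h \<in> ssep P W"
          then have h: "P h \<noteq> Zero" "W h = flip (P h)" by (auto simp: mem_ssep)
          moreover have "W h \<in> {Zero, Z h, P1 h}" "P1 h = Zero \<or> P1 h = P h"
            using W P1 by (auto simp: sle_def)
          ultimately show "h \<in> ssep P Z - {g}" using W(2) by (auto simp: mem_ssep)
        qed
        moreover have "finite (ssep P Z)"
          using finite_ssupp[OF less.prems(1)] by (rule rev_finite_subset) (auto simp: ssep_def)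
        ultimately have "card (ssep P W) < card (ssep P Z)"
          using g by (intro psubset_card_mono) auto
        moreover have "\<forall>h. P h \<noteq> Zero \<or> W h \<in> {Zero, X h}"
        proof
          fix h
          have "W h \<in> {Zero, Z h, P1 h}" "P1 h = Zero \<or> P1 h = P h"
            using W P1 by (auto simp: sle_def)
          then show "P h \<noteq> Zero \<or> W h \<in> {Zero, X h}" using less.prems(3) by auto
        qed
        ultimately show ?thesis using less.hyps[of W] W less.prems by simp
      qed
    qed
    moreover have "X e \<noteq> Zero" using snoc.prems Pe by (simp add: scirc_apply)
    ultimately show ?thesis using snoc.hyps by blast
  qed
qed

lemma compositions_scirc: "P \<in> compositions \<Longrightarrow> Q \<in> compositions \<Longrightarrow> scirc P Q \<in> compositions"
proof (rotate_tac, induction rule: compositions.induct)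
  case zero
  then show ?case by (simp add: scirc_def)
next
  case (snoc Q X)
  have "scirc P (scirc Q X) = scirc (scirc P Q) X" by (auto simp: scirc_def)
  then show ?case using snoc compositions.snoc by simp
qed

lemma compositions_sneg: "P \<in> compositions \<Longrightarrow> sneg P \<in> compositions"
proof (induction rule: compositions.induct)
  case zero
  have *: "sneg szero = szero" by (simp add: sneg_def szero_def)
  show ?case unfolding * by (rule compositions.zero)
next
  case (snoc P X)
  have "sneg (scirc P X) = scirc (sneg P) (sneg X)" by (auto simp: sneg_def scirc_def)
  then show ?case using compositions.snoc[OF snoc.IH neg[OF snoc.hyps(2)]] by (simp only:)
qed

lemma C_subset_compositions: "X \<in> C \<Longrightarrow> X \<in> compositions"
proof -
  assume "X \<in> C"
  then have "scirc szero X \<in> compositions" by (intro compositions.intros)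
  then show ?thesis by (simp add: scirc_def szero_def)
qed

lemma compositions_ssupp: "P \<in> compositions \<Longrightarrow> ssupp P \<subseteq> E"
proof (induction rule: compositions.induct)
  case zero
  then show ?case by auto
next
  case (snoc P X)
  have "ssupp (scirc P X) \<subseteq> ssupp P \<union> ssupp X" by (auto simp: scirc_apply)
  then show ?case using snoc supp[of X] by blast
qed

text \<open>Conformal decomposition supplies cocircuits \<open>X\<close> below \<open>P\<close>
  through \<open>f\<close> and \<open>Y\<close> below \<open>Q\<close> through \<open>e\<close>.
  Either \<open>X\<close> already avoids \<open>e\<close>, or \<open>X\<close> and \<open>Y\<close>
  are separated there and elimination of cocircuits applies; the result is again a single
  cocircuit.\<close>

lemma compositions_elim_keep:
  assumes "P \<in> compositions" "Q \<in> compositions" "e \<in> ssep P Q" "P f \<noteq> Zero" "f \<notin> ssep P Q"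
  shows "\<exists>Z\<in>C. Z e = Zero \<and> Z f = P f \<and> (\<forall>h. Z h \<in> {Zero, P h, Q h})"
proof -
  obtain X where X: "X \<in> C" "sle X P" "X f \<noteq> Zero" using conformal_below assms by blast
  have Xf: "X f = P f" using X by (auto simp: sle_def)
  show ?thesis
  proof (cases "X e = Zero")
    case True
    then show ?thesis using X Xf by (auto simp: sle_def)
  next
    case False
    then have Xe: "X e = P e" using X by (auto simp: sle_def)
    have "Q e \<noteq> Zero" using assms by (auto simp: mem_ssep)
    then obtain Y where Y: "Y \<in> C" "sle Y Q" "Y e \<noteq> Zero" using conformal_below assms by blast
    have Ye: "Y e = Q e" using Y by (auto simp: sle_def)
    have "e \<in> ssep X Y" using Xe Ye assms by (auto simp: mem_ssep)
    moreover have "f \<notin> ssep X Y"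
      using Xf Y(2) assms unfolding mem_ssep sle_def by (metis flip_eq_Zero(1))
    ultimately obtain Z where Z: "Z \<in> C" "Z e = Zero" "Z f = X f" "\<forall>h. Z h \<in> {Zero, X h, Y h}"
      using elim_keep[OF X(1) Y(1)] X(3) by blast
    have "Z h \<in> {Zero, P h, Q h}" for h
    proof -
      have "Z h \<in> {Zero, X h, Y h}" "X h = Zero \<or> X h = P h" "Y h = Zero \<or> Y h = Q h"
        using Z X(2) Y(2) unfolding sle_def by blast+
      then show ?thesis by auto
    qed
    then show ?thesis using Z Xf by auto
  qed
qed

text \<open>For each \<open>f\<close> off the separator one cocircuit has the right sign at
  \<open>f\<close> and vanishes at \<open>e\<close>. Composing these finitely many cocircuits gives
  all signs at once.\<close>

lemma compositions_elim:
  assumes "P \<in> compositions" "Q \<in> compositions" "e \<in> ssep P Q"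
  shows "\<exists>Z\<in>compositions. Z e = Zero \<and> (\<forall>f. f \<notin> ssep P Q \<longrightarrow> Z f = scirc P Q f)"
proof -
  define D where "D = (ssupp P \<union> ssupp Q) - ssep P Q"
  have finD: "finite D"
    using assms compositions_ssupp fin unfolding D_def by (meson finite_Diff finite_Un finite_subset)
  have one: "\<exists>Z\<in>C. Z e = Zero \<and> Z f = scirc P Q f \<and> (\<forall>h. Z h \<in> {Zero, P h, Q h})" if "f \<in> D" for f
  proof (cases "P f = Zero")
    case False
    then show ?thesis using compositions_elim_keep[OF assms(1-3), of f] that
      by (auto simp: D_def scirc_apply)
  next
    case True
    then show ?thesis using compositions_elim_keep[OF assms(2,1), of e f] that assms(3)
      by (auto simp: D_def scirc_apply ssep_commute[of Q P])
  qed
  have "\<exists>Z\<in>compositions. Z e = Zero \<and> (\<forall>f\<in>F. Z f = scirc P Q f) \<and> (\<forall>h. Z h \<in> {Zero, P h, Q h})"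
    if "finite F" "F \<subseteq> D" for F
    using that
  proof (induction F)
    case empty
    show ?case by (rule bexI[OF _ compositions.zero]) simp
  next
    case (insert f F)
    then obtain Z where Z: "Z \<in> compositions" "Z e = Zero" "\<forall>f\<in>F. Z f = scirc P Q f"
      "\<forall>h. Z h \<in> {Zero, P h, Q h}" using insert.IH by blast
    obtain X where X: "X \<in> C" "X e = Zero" "X f = scirc P Q f" "\<forall>h. X h \<in> {Zero, P h, Q h}"
      using one insert.prems by blast
    \<comment> \<open>Off the separator the nonzero signs of \<open>P\<close> and \<open>Q\<close>
      agree, so a partial composition is right wherever it is nonzero and the next factor cannot be
      overruled by a wrong sign.\<close>
    have ZF: "Z h = scirc P Q h" if "h \<in> D" "Z h \<noteq> Zero" for h
    proof -
      have "Z h \<in> {Zero, P h, Q h}" using Z by blast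
      then show ?thesis using that sign_cases2[of "P h" "Q h"]
        by (auto simp: D_def scirc_apply mem_ssep)
    qed
    have nz: "scirc P Q h \<noteq> Zero" if "h \<in> D" for h
      using that by (auto simp: D_def scirc_apply)
    have "scirc Z X \<in> compositions" using Z X compositions.snoc by blast
    moreover have "scirc Z X e = Zero" using Z X by (simp add: scirc_apply)
    moreover have "\<forall>h\<in>insert f F. scirc Z X h = scirc P Q h"
    proof
      fix h assume "h \<in> insert f F"
      then consider "h = f" | "h \<in> F" by blast
      then show "scirc Z X h = scirc P Q h"
      proof cases
        case 1
        then show ?thesis using X ZF[of f] insert.prems by (auto simp: scirc_apply[of Z X])
      next
        case 2
        then show ?thesis using Z nz insert.prems by (auto simp: scirc_apply[of Z X])
      qed
    qed
    moreover have "\<forall>h. scirc Z X h \<in> {Zero, P h, Q h}"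
      using Z(4) X(4) by (auto simp: scirc_apply)
    ultimately show ?case by blast
  qed
  then obtain Z where Z: "Z \<in> compositions" "Z e = Zero" "\<forall>f\<in>D. Z f = scirc P Q f"
      "\<forall>h. Z h \<in> {Zero, P h, Q h}"
    using finD by blast
  have "Z f = scirc P Q f" if "f \<notin> ssep P Q" for f
  proof (cases "f \<in> D")
    case False
    then have "P f = Zero" "Q f = Zero" using that by (auto simp: D_def)
    then show ?thesis using Z(4) by (metis empty_iff insert_iff scirc_apply)
  qed (use Z in blast)
  then show ?thesis using Z by blast
qed

end

section \<open>Faces of covectors\<close>

text \<open>The covector axioms of an oriented matroid. Elements of \<open>E\<close> at which all
  covectors vanish are allowed, so minors can keep the ground set.\<close>

locale covector_system =
  fixes E :: "'a set" and L :: "('a \<Rightarrow> sign) set"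
  assumes finite_ground: "finite E"
    and L_ssupp: "X \<in> L \<Longrightarrow> ssupp X \<subseteq> E"
    and L_zero: "szero \<in> L"
    and L_neg: "X \<in> L \<Longrightarrow> sneg X \<in> L"
    and L_circ: "X \<in> L \<Longrightarrow> Y \<in> L \<Longrightarrow> scirc X Y \<in> L"
    and L_elim: "X \<in> L \<Longrightarrow> Y \<in> L \<Longrightarrow> e \<in> ssep X Y \<Longrightarrow>
      \<exists>Z\<in>L. Z e = Zero \<and> (\<forall>f. f \<notin> ssep X Y \<longrightarrow> Z f = scirc X Y f)"
begin

lemma finite_L_ssupp: "X \<in> L \<Longrightarrow> finite (ssupp X)"
  using finite_ground L_ssupp finite_subset by blast

lemma finite_ssep: "X \<in> L \<Longrightarrow> finite (ssep X Y)"
  by (rule finite_subset[OF _ finite_L_ssupp[of X]]) (auto simp: ssep_def)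

lemma finite_L: "finite L"
proof -
  have "L \<subseteq> {X. \<forall>e. (e \<in> E \<longrightarrow> X e \<in> {Plus, Minus, Zero}) \<and> (e \<notin> E \<longrightarrow> X e = Zero)}"
  proof
    fix X assume "X \<in> L"
    then have "ssupp X \<subseteq> E" by (rule L_ssupp)
    moreover have "s \<in> {Plus, Minus, Zero}" for s by (cases s) auto
    ultimately show "X \<in> {X. \<forall>e. (e \<in> E \<longrightarrow> X e \<in> {Plus, Minus, Zero}) \<and> (e \<notin> E \<longrightarrow> X e = Zero)}"
      by (auto simp: subset_iff)
  qed
  moreover have "finite {X. \<forall>e. (e \<in> E \<longrightarrow> X e \<in> {Plus, Minus, Zero}) \<and> (e \<notin> E \<longrightarrow> X e = Zero)}"
    by (rule finite_set_of_finite_funs[OF finite_ground]) simp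
  ultimately show ?thesis by (rule finite_subset)
qed

text \<open>Move from \<open>T\<close> towards \<open>V\<close> until the first coordinates of \<open>T\<close> vanish.\<close>

lemma first_exit:
  assumes "T \<in> L" "V \<in> L" "ssep T V \<noteq> {}"
  shows "\<exists>W\<in>L. (\<forall>f. f \<notin> ssep T V \<longrightarrow> W f = scirc T V f) \<and>
    (\<forall>f\<in>ssep T V. W f = Zero \<or> W f = T f) \<and> (\<exists>f\<in>ssep T V. W f = Zero)"
  using assms(2,3)
proof (induction "card (ssep T V)" arbitrary: V rule: less_induct)
  case less
  then obtain e where e: "e \<in> ssep T V" by blast
  obtain W where W: "W \<in> L" "W e = Zero" "\<forall>f. f \<notin> ssep T V \<longrightarrow> W f = scirc T V f"
    using L_elim[OF assms(1) less.prems(1) e] by blast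
  have out: "scirc T W f = scirc T V f \<and> f \<notin> ssep T W" if "f \<notin> ssep T V" for f
    using that W(3) by (auto simp: scirc_apply mem_ssep)
  show ?case
  proof (cases "ssep T W = {}")
    case True
    have "W f = Zero \<or> W f = T f" if "f \<in> ssep T V" for f
      using that True sign_cases2[of "T f" "W f"] by (auto simp: ssep_def)
    then show ?thesis using W e by blast
  next
    case False
    have sub: "ssep T W \<subseteq> ssep T V - {e}"
    proof
      fix f assume f: "f \<in> ssep T W"
      then have "f \<noteq> e" using W(2) by (auto simp: mem_ssep)
      then show "f \<in> ssep T V - {e}" using f out by blast
    qed
    then have "card (ssep T W) < card (ssep T V)"
      using e finite_ssep[OF assms(1)] by (intro psubset_card_mono) auto
    then obtain Z where Z: "Z \<in> L" "\<forall>f. f \<notin> ssep T W \<longrightarrow> Z f = scirc T W f"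
        "\<forall>f\<in>ssep T W. Z f = Zero \<or> Z f = T f" "\<exists>f\<in>ssep T W. Z f = Zero"
      using less.hyps[of W] W(1) False by blast
    have "Z f = scirc T V f" if "f \<notin> ssep T V" for f
      using Z(2) out[OF that] by simp
    moreover have "Z f = Zero \<or> Z f = T f" if "f \<in> ssep T V" for f
      using that Z(2,3) by (cases "f \<in> ssep T W") (auto simp: scirc_apply mem_ssep)
    ultimately show ?thesis using Z(1,4) sub by blast
  qed
qed

section \<open>Minimal nonzero covectors\<close>

definition atoms :: "('a \<Rightarrow> sign) set" where
  "atoms = {X \<in> L. X \<noteq> szero \<and> (\<forall>Y\<in>L. Y \<noteq> szero \<longrightarrow> sle Y X \<longrightarrow> Y = X)}"

lemma atomsD: "X \<in> atoms \<Longrightarrow> X \<in> L" "X \<in> atoms \<Longrightarrow> X \<noteq> szero"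
    "X \<in> atoms \<Longrightarrow> Y \<in> L \<Longrightarrow> Y \<noteq> szero \<Longrightarrow> sle Y X \<Longrightarrow> Y = X"
  by (auto simp: atoms_def)

lemma finite_atoms: "finite atoms"
  using finite_L by (simp add: atoms_def)

text \<open>By descent in the support: a strictly smaller nonzero covector either keeps
  \<open>e\<close>, or can be subtracted from \<open>W\<close> without touching
  \<open>e\<close>.\<close>

lemma atom_below:
  assumes "W \<in> L" "W e \<noteq> Zero"
  shows "\<exists>z\<in>atoms. sle z W \<and> z e \<noteq> Zero"
  using assms
proof (induction "card (ssupp W)" arbitrary: W rule: less_induct)
  case less
  show ?case
  proof (cases "W \<in> atoms")
    case True
    then show ?thesis using less.prems by (intro bexI[of _ W]) auto
  next
    case False
    then obtain Y where Y: "Y \<in> L" "Y \<noteq> szero" "sle Y W" "Y \<noteq> W"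
      using less.prems nonzero_ex by (auto simp: atoms_def)
    have step: ?thesis if V: "V \<in> L" "sle V W" "V \<noteq> W" "V e \<noteq> Zero" for V
    proof -
      have "card (ssupp V) < card (ssupp W)"
        using V less.prems finite_L_ssupp sle_ssupp_psubset by (meson psubset_card_mono)
      then show ?thesis using less.hyps[of V] V sle_trans by blast
    qed
    show ?thesis
    proof (cases "Y e = Zero")
      case False
      then show ?thesis by (rule step[OF Y(1,3,4)])
    next
      case Ye: True
      obtain h where h: "Y h \<noteq> Zero" using Y(2) unfolding nonzero_ex by blast
      have YW: "Y f = Zero \<or> Y f = W f" for f using Y(3) by (simp add: sle_def)
      \<comment> \<open>Moving from \<open>W\<close> towards \<open>sneg Y\<close> stops when the
        first coordinate in the support of \<open>Y\<close> vanishes. The sign at \<open>e\<close>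
        survives because \<open>Y e = Zero\<close>, so the exit point is a smaller covector through
        \<open>e\<close>.\<close>
      have "h \<in> ssep W (sneg Y)" using h YW[of h] by (auto simp: mem_ssep)
      then obtain V where V: "V \<in> L" "\<forall>f. f \<notin> ssep W (sneg Y) \<longrightarrow> V f = scirc W (sneg Y) f"
          "\<forall>f\<in>ssep W (sneg Y). V f = Zero \<or> V f = W f" "\<exists>f\<in>ssep W (sneg Y). V f = Zero"
        using first_exit[OF less.prems(1) L_neg[OF Y(1)]] by blast
      have "V f = Zero \<or> V f = W f" for f
        using V(2,3) YW[of f] by (cases "f \<in> ssep W (sneg Y)") (auto simp: scirc_apply)
      then have "sle V W" by (simp add: sle_def)
      moreover have "V \<noteq> W" using V(4) by (auto simp: mem_ssep)
      moreover have "V e \<noteq> Zero" using V(2) less.prems(2) Ye by (auto simp: mem_ssep scirc_apply)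
      ultimately show ?thesis by (rule step[OF V(1)])
    qed
  qed
qed

lemma atom_ex: "W \<in> L \<Longrightarrow> W \<noteq> szero \<Longrightarrow> \<exists>z\<in>atoms. sle z W"
  using atom_below nonzero_ex by metis

text \<open>Without a conflict \<open>W\<close> lies below \<open>v\<close>. With a conflict, the
  first exit from \<open>v\<close> towards \<open>W\<close> is strictly below \<open>v\<close>,
  hence zero, and this forces \<open>W\<close> to be opposite to \<open>v\<close>
  everywhere.\<close>

lemma atom_ssupp:
  assumes "v \<in> atoms" "W \<in> L" "W \<noteq> szero" "ssupp W \<subseteq> ssupp v"
  shows "W = v \<or> W = sneg v"
proof (cases "ssep v W = {}")
  case True
  have "W f = Zero \<or> W f = v f" for f
    using True assms(4) sign_cases2[of "v f" "W f"] by (auto simp: ssep_def)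
  then have "sle W v" by (simp add: sle_def)
  then show ?thesis using assms atomsD(3) by blast
next
  case False
  obtain V where V: "V \<in> L" "\<forall>f. f \<notin> ssep v W \<longrightarrow> V f = scirc v W f"
      "\<forall>f\<in>ssep v W. V f = Zero \<or> V f = v f" "\<exists>f\<in>ssep v W. V f = Zero"
    using first_exit[OF atomsD(1)[OF assms(1)] assms(2) False] by blast
  have out: "v f = Zero \<Longrightarrow> W f = Zero" for f using assms(4) by auto
  have "V f = Zero \<or> V f = v f" for f
    using V(2,3) out[of f] by (cases "f \<in> ssep v W") (auto simp: scirc_apply)
  then have "sle V v" by (simp add: sle_def)
  moreover have "V \<noteq> v" using V(4) by (auto simp: mem_ssep)
  ultimately have V0: "V = szero" using atomsD(3)[OF assms(1) V(1)] by blast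
  have "W f = flip (v f)" for f
  proof (cases "f \<in> ssep v W")
    case False
    then have "scirc v W f = Zero" using V(2) V0 by (metis szero_apply)
    then show ?thesis by (auto simp: scirc_apply split: if_splits)
  qed (simp add: mem_ssep)
  then show ?thesis by (auto simp: sneg_def)
qed

text \<open>For \<open>D = {}\<close> and \<open>K\<close> the support of \<open>v\<close> below, these are faces of \<open>T\<close> not containing \<open>v\<close>;
  on the elements of \<open>D\<close> the signs are unconstrained.\<close>

definition antistar :: "('a \<Rightarrow> sign) \<Rightarrow> 'a set \<Rightarrow> 'a set \<Rightarrow> ('a \<Rightarrow> sign) set" where
  "antistar T K D = {W \<in> L. (\<forall>g. g \<notin> D \<longrightarrow> W g = Zero \<or> W g = T g) \<and>
     (\<exists>h. h \<notin> K \<and> W h \<noteq> Zero) \<and> (\<exists>e\<in>K - D. W e = Zero)}"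

text \<open>Inclusion of faces with the coordinates in \<open>D\<close> forgotten. It is only a
  preorder: elements that differ on \<open>D\<close> alone are below each other.\<close>

definition le_off :: "'a set \<Rightarrow> ('a \<Rightarrow> sign) \<Rightarrow> ('a \<Rightarrow> sign) \<Rightarrow> bool" where
  "le_off D X Y \<longleftrightarrow> (\<forall>g. g \<notin> D \<longrightarrow> X g = Zero \<or> X g = Y g)"

definition antistar_link ::
    "('a \<Rightarrow> sign) \<Rightarrow> 'a set \<Rightarrow> 'a set \<Rightarrow> ('a \<Rightarrow> sign) \<Rightarrow> ('a \<Rightarrow> sign) \<Rightarrow> bool" where
  "antistar_link T K D X Y \<longleftrightarrow> X \<in> antistar T K D \<and> Y \<in> antistar T K D \<and>
     (le_off D X Y \<or> le_off D Y X)"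

lemma antistar_link_sym: "(antistar_link T K D)\<^sup>*\<^sup>* X Y \<Longrightarrow> (antistar_link T K D)\<^sup>*\<^sup>* Y X"
proof -
  have "symp (antistar_link T K D)" by (auto simp: symp_def antistar_link_def)
  then show "(antistar_link T K D)\<^sup>*\<^sup>* X Y \<Longrightarrow> (antistar_link T K D)\<^sup>*\<^sup>* Y X"
    using sympD[OF symp_rtranclp] by metis
qed

lemma antistar_circ:
  assumes "p \<in> antistar T K D" "q \<in> L" "\<forall>g. g \<notin> D \<longrightarrow> q g = Zero \<or> q g = T g"
    "e \<in> K - D" "p e = Zero" "q e = Zero"
  shows "scirc p q \<in> antistar T K D" "le_off D p (scirc p q)" "le_off D q (scirc p q)"
proof -
  have p: "p \<in> L" "\<forall>g. g \<notin> D \<longrightarrow> p g = Zero \<or> p g = T g" "\<exists>h. h \<notin> K \<and> p h \<noteq> Zero"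
    using assms by (auto simp: antistar_def)
  show "scirc p q \<in> antistar T K D"
    using p assms(2-) L_circ by (auto simp: antistar_def scirc_apply)
  show "le_off D p (scirc p q)" by (auto simp: le_off_def scirc_apply)
  show "le_off D q (scirc p q)" using p assms(3) by (fastforce simp: le_off_def scirc_apply)
qed

text \<open>The composition lies above both, and the common zero in \<open>K - D\<close> keeps it in
  the antistar.\<close>

lemma antistar_join:
  assumes "p \<in> antistar T K D" "q \<in> antistar T K D" "e \<in> K - D" "p e = Zero" "q e = Zero"
  shows "(antistar_link T K D)\<^sup>*\<^sup>* p q"
proof -
  have q: "q \<in> L" "\<forall>g. g \<notin> D \<longrightarrow> q g = Zero \<or> q g = T g"
    using assms by (auto simp: antistar_def)
  note * = antistar_circ[OF assms(1) q assms(3-5)]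
  have "antistar_link T K D p (scirc p q)" "antistar_link T K D (scirc p q) q"
    using * assms by (auto simp: antistar_link_def)
  then show ?thesis by (meson r_into_rtranclp rtranclp_trans)
qed

text \<open>The path for the relaxed set \<open>insert g D\<close> is followed by elements
  \<open>w'\<close> that have the correct side at \<open>g\<close> and agree with it off
  \<open>insert g D\<close>. Going up, \<open>scirc w' w2\<close> keeps the sign of
  \<open>w'\<close> at \<open>g\<close>. Going down to the wrong side forces a crossing of
  \<open>g\<close>, and the second alternative records the crossing point.\<close>

lemma antistar_lift_path:
  assumes g: "g \<in> K" "g \<notin> D" "T g \<noteq> Zero" "D \<subseteq> K"
    and x: "x \<in> antistar T K D"
    and path: "(antistar_link T K (insert g D))\<^sup>*\<^sup>* x w"
  shows "(\<exists>w'\<in>antistar T K D. (\<forall>h. h \<notin> insert g D \<longrightarrow> w' h = w h) \<and> (antistar_link T K D)\<^sup>*\<^sup>* x w') \<or>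
    (\<exists>p\<in>antistar T K D. p g = Zero \<and> (antistar_link T K D)\<^sup>*\<^sup>* x p)"
  using path
proof (induction rule: rtranclp_induct)
  case base
  then show ?case using x by blast
next
  case (step w w2)
  show ?case
  proof (cases "\<exists>p\<in>antistar T K D. p g = Zero \<and> (antistar_link T K D)\<^sup>*\<^sup>* x p")
    case False
    then obtain w' where w': "w' \<in> antistar T K D" "\<forall>h. h \<notin> insert g D \<longrightarrow> w' h = w h"
        "(antistar_link T K D)\<^sup>*\<^sup>* x w'" using step.IH by blast
    have reach: ?thesis if "u \<in> antistar T K D" "(antistar_link T K D)\<^sup>*\<^sup>* w' u"
        "u g = Zero \<or> (\<forall>h. h \<notin> insert g D \<longrightarrow> u h = w2 h)" for u
      using that w'(3) by (metis rtranclp_trans)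
    have w2: "w2 \<in> antistar T K (insert g D)" and w: "w \<in> antistar T K (insert g D)"
      and lew: "le_off (insert g D) w w2 \<or> le_off (insert g D) w2 w"
      using step.hyps(2) by (auto simp: antistar_link_def)
    have w'L: "w' \<in> L" "\<forall>h. h \<notin> D \<longrightarrow> w' h = Zero \<or> w' h = T h" "\<exists>h. h \<notin> K \<and> w' h \<noteq> Zero"
      using w' by (auto simp: antistar_def)
    have w2L: "w2 \<in> L" "\<forall>h. h \<notin> insert g D \<longrightarrow> w2 h = Zero \<or> w2 h = T h"
        "\<exists>h. h \<notin> K \<and> w2 h \<noteq> Zero"
      using w2 by (auto simp: antistar_def)
    obtain e2 where e2: "e2 \<in> K" "e2 \<notin> D" "e2 \<noteq> g" "w2 e2 = Zero"
      using w2 by (auto simp: antistar_def)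
    obtain e where e: "e \<in> K" "e \<notin> D" "e \<noteq> g" "w e = Zero"
      using w by (auto simp: antistar_def)
    have w'e: "w' e = Zero" using w'(2) e by auto
    show ?thesis
    proof (cases "w2 g = flip (T g)")
      case good: False
      then have w2g: "w2 g = Zero \<or> w2 g = T g" using sign_cases2[of "T g" "w2 g"] g by auto
      then have w2A: "\<forall>h. h \<notin> D \<longrightarrow> w2 h = Zero \<or> w2 h = T h" using w2L by auto
      have w2in: "w2 \<in> antistar T K D" using w2L w2A e2 by (auto simp: antistar_def)
      show ?thesis
      proof (cases "le_off (insert g D) w w2")
        case True
        then have w'w2: "h \<notin> insert g D \<Longrightarrow> w' h = Zero \<or> w' h = w2 h" for h
          using w'(2) by (auto simp: le_off_def)
        have "w' e2 = Zero" using w'w2[of e2] e2 by auto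
        then have *: "scirc w' w2 \<in> antistar T K D" "le_off D w' (scirc w' w2)"
          using antistar_circ[OF w'(1) w2L(1) w2A, of e2] e2 by auto
        have "\<forall>h. h \<notin> insert g D \<longrightarrow> scirc w' w2 h = w2 h"
          using w'w2 by (auto simp: scirc_apply)
        moreover have "antistar_link T K D w' (scirc w' w2)"
          using * w' by (auto simp: antistar_link_def)
        ultimately show ?thesis using reach * by blast
      next
        case False
        then have w2w': "h \<notin> insert g D \<Longrightarrow> w2 h = Zero \<or> w2 h = w' h" for h
          using w'(2) lew by (auto simp: le_off_def)
        have "w2 e = Zero" using w2w'[of e] e w'e by auto
        then have *: "scirc w2 w' \<in> antistar T K D" "le_off D w2 (scirc w2 w')"
            "le_off D w' (scirc w2 w')"
          using antistar_circ[OF w2in w'L(1,2), of e] e w'e by auto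
        have "antistar_link T K D w' (scirc w2 w')" "antistar_link T K D (scirc w2 w') w2"
          using * w' w2in by (auto simp: antistar_link_def)
        then have "(antistar_link T K D)\<^sup>*\<^sup>* w' w2" by (meson r_into_rtranclp rtranclp_trans)
        then show ?thesis using reach w2in by blast
      qed
    next
      case bad: True
      \<comment> \<open>A zero of \<open>w'\<close> at \<open>g\<close> would be a crossing point,
        which the current case excludes.\<close>
      have w'g: "w' g = T g" using False w' w'L(2) g by auto
      show ?thesis
      proof (cases "le_off (insert g D) w w2")
        case True
        then have w'w2: "h \<notin> insert g D \<Longrightarrow> w' h = Zero \<or> w' h = w2 h" for h
          using w'(2) by (auto simp: le_off_def)
        have "w' e2 = Zero" using w'w2[of e2] e2 by auto
        moreover have good: "scirc w' w2 h = Zero \<or> scirc w' w2 h = T h" if "h \<notin> D" for h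
          using that w'w2[of h] w'L w2L(2) w'g by (cases "h = g") (auto simp: scirc_apply g)
        ultimately have *: "scirc w' w2 \<in> antistar T K D"
          using w'L L_circ[OF w'L(1) w2L(1)] e2 by (auto simp: antistar_def scirc_apply)
        have "\<forall>h. h \<notin> insert g D \<longrightarrow> scirc w' w2 h = w2 h"
          using w'w2 by (auto simp: scirc_apply)
        moreover have "antistar_link T K D w' (scirc w' w2)"
          using * w' by (auto simp: antistar_link_def le_off_def scirc_apply)
        ultimately show ?thesis using reach * by blast
      next
        case False
        then have w2w': "h \<notin> insert g D \<Longrightarrow> w2 h = Zero \<or> w2 h = w' h" for h
          using w'(2) lew by (auto simp: le_off_def)
        \<comment> \<open>Off \<open>insert g D\<close> this agrees with \<open>w'\<close>, but it
          lies on the other side of \<open>g\<close>. Eliminating \<open>g\<close> between the two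
          leaves their common signs alone and gives a face of \<open>w'\<close> (up to
          \<open>D\<close>) with a zero at \<open>g\<close>.\<close>
        define u where "u = scirc w2 w'"
        have u: "u \<in> L" "u g = flip (w' g)" "\<forall>h. h \<notin> insert g D \<longrightarrow> u h = w' h"
          using L_circ[OF w2L(1) w'L(1)] bad w'g w2w' g by (auto simp: u_def scirc_apply)
        have "g \<in> ssep w' u" using u w'g g by (auto simp: mem_ssep)
        then obtain p where p: "p \<in> L" "p g = Zero" "\<forall>f. f \<notin> ssep w' u \<longrightarrow> p f = scirc w' u f"
          using L_elim[OF w'L(1) u(1)] by blast
        have pw: "p h = w' h" if "h \<notin> insert g D" for h
        proof -
          have "u h = w' h" using that u(3) by blast
          then have "h \<notin> ssep w' u" "scirc w' u h = w' h" by (auto simp: mem_ssep scirc_apply)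
          then show ?thesis using p(3) by auto
        qed
        have "\<forall>h. h \<notin> D \<longrightarrow> p h = Zero \<or> p h = T h"
          using pw p(2) w'L(2) by (metis insert_iff)
        moreover have "\<exists>h. h \<notin> K \<and> p h \<noteq> Zero"
        proof -
          obtain h where h: "h \<notin> K" "w' h \<noteq> Zero" using w'L by blast
          then have "h \<notin> insert g D" using g by auto
          then have "h \<notin> ssep w' u" using u h by (auto simp: mem_ssep)
          then show ?thesis using p(3) h by (auto simp: scirc_apply)
        qed
        moreover have "p e = Zero" using pw w'e e by auto
        ultimately have *: "p \<in> antistar T K D" using p e by (auto simp: antistar_def)
        have "le_off D p w'" unfolding le_off_def using pw p(2) by (metis insert_iff)
        then have "antistar_link T K D w' p" using * w'(1) by (simp add: antistar_link_def)
        then show ?thesis using reach * p(2) by blast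
      qed
    qed
  qed blast
qed

text \<open>Two elements with a common zero in \<open>K - D\<close> are joined directly. Otherwise a
  third element \<open>g\<close> of \<open>K - D\<close> is relaxed, or, if there is none, an
  explicit intermediate element is built from \<open>sneg v\<close>.\<close>

lemma antistar_connected:
  assumes T: "T \<in> L" and v: "v \<in> L" "sle v T" "K = ssupp v"
    and D: "D \<subseteq> K" and x: "x \<in> antistar T K D" and y: "y \<in> antistar T K D"
  shows "(antistar_link T K D)\<^sup>*\<^sup>* x y"
  using D x y
proof (induction "card (K - D)" arbitrary: D rule: less_induct)
  case less
  have vT: "v g = T g" "T g \<noteq> Zero" if "g \<in> K" for g
    using that v by (auto simp: sle_def)
  obtain e f where e: "e \<in> K - D" "x e = Zero" and f: "f \<in> K - D" "y f = Zero"
    using less.prems by (auto simp: antistar_def)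
  show ?case
  proof (cases "x f = Zero \<or> y e = Zero")
    case True
    then show ?thesis using antistar_join[OF less.prems(2,3)] e f by blast
  next
    case False
    have x: "x \<in> L" "\<forall>h. h \<notin> D \<longrightarrow> x h = Zero \<or> x h = T h" "\<exists>h. h \<notin> K \<and> x h \<noteq> Zero"
      using less.prems(2) by (auto simp: antistar_def)
    have y: "y \<in> L" "\<forall>h. h \<notin> D \<longrightarrow> y h = Zero \<or> y h = T h" "\<exists>h. h \<notin> K \<and> y h \<noteq> Zero"
      using less.prems(3) by (auto simp: antistar_def)
    have ne: "e \<noteq> f" and xf: "x f = T f" and ye: "y e = T e"
      using False e f x y by auto
    show ?thesis
    proof (cases "K - D \<subseteq> {e, f}")
      case True
      \<comment> \<open>Only \<open>e\<close> and \<open>f\<close> remain constrained on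
        \<open>K\<close>. Pushing \<open>y\<close> towards \<open>sneg v\<close> until
        \<open>e\<close> vanishes gives \<open>W\<close>, unchanged off \<open>K\<close> and
        opposite to \<open>x\<close> at \<open>f\<close>; eliminating \<open>f\<close> between
        \<open>x\<close> and \<open>W\<close> then yields \<open>p\<close> vanishing at both, so
        \<open>p\<close> joins \<open>x\<close> through \<open>e\<close> and \<open>y\<close>
        through \<open>f\<close>.\<close>
      have "e \<in> ssep y (sneg v)" using ye vT[of e] e by (auto simp: mem_ssep)
      then obtain W where W: "W \<in> L" "W e = Zero"
          "\<forall>h. h \<notin> ssep y (sneg v) \<longrightarrow> W h = scirc y (sneg v) h"
        using L_elim[OF y(1) L_neg[OF v(1)]] by blast
      have Wf: "W f = flip (T f)" using W(3) f vT[of f] by (auto simp: mem_ssep scirc_apply)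
      have Wout: "W h = y h" if "h \<notin> K" for h
      proof -
        have "v h = Zero" using that v(3) by simp
        then have "h \<notin> ssep y (sneg v)" "scirc y (sneg v) h = y h" by (auto simp: mem_ssep scirc_apply)
        then show ?thesis using W(3) by metis
      qed
      have "f \<in> ssep x W" using xf Wf vT[of f] f by (auto simp: mem_ssep)
      then obtain p where p: "p \<in> L" "p f = Zero" "\<forall>h. h \<notin> ssep x W \<longrightarrow> p h = scirc x W h"
        using L_elim[OF x(1) W(1)] by blast
      have pe: "p e = Zero" using p(3) e(2) W(2) by (auto simp: mem_ssep scirc_apply)
      have pout: "p h = (if x h = Zero then y h else x h)" if "h \<notin> K" for h
      proof -
        have "h \<notin> D" using that less.prems(1) by auto
        then have "x h = Zero \<or> y h = Zero \<or> y h = x h" using x(2) y(2) by metis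
        then have "h \<notin> ssep x W" using Wout[OF that] by (auto simp: mem_ssep)
        then show ?thesis using p(3) Wout[OF that] by (simp add: scirc_apply)
      qed
      have "p h = Zero \<or> p h = T h" if "h \<notin> D" for h
      proof (cases "h \<in> K")
        case True
        then have "h = e \<or> h = f" using that \<open>K - D \<subseteq> {e, f}\<close> by blast
        then show ?thesis using p(2) pe by auto
      qed (use pout x(2) y(2) that in auto)
      moreover have "\<exists>h. h \<notin> K \<and> p h \<noteq> Zero" using pout x(3) by auto
      ultimately have pA: "p \<in> antistar T K D" using p(1) pe e by (auto simp: antistar_def)
      have "(antistar_link T K D)\<^sup>*\<^sup>* x p" using antistar_join[OF less.prems(2) pA] e pe by blast
      moreover have "(antistar_link T K D)\<^sup>*\<^sup>* p y"
        using antistar_join[OF pA less.prems(3)] f p(2) by blast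
      ultimately show ?thesis by (rule rtranclp_trans)
    next
      case False
      then obtain g where g: "g \<in> K" "g \<notin> D" "g \<noteq> e" "g \<noteq> f" by blast
      have "finite K" using v finite_L_ssupp by blast
      then have "card (K - insert g D) < card (K - D)"
        using g by (intro psubset_card_mono) auto
      moreover have "x \<in> antistar T K (insert g D)" "y \<in> antistar T K (insert g D)"
        using x y e f g by (auto simp: antistar_def)
      ultimately have path: "(antistar_link T K (insert g D))\<^sup>*\<^sup>* x y"
        using less.hyps[of "insert g D"] g less.prems(1) by blast
      note Tg = vT(2)[OF g(1)]
      \<comment> \<open>Only \<open>g\<close> can still distinguish the two, and there both signs
        are \<open>Zero\<close> or \<open>T g\<close>, hence comparable.\<close>
      have close: "(antistar_link T K D)\<^sup>*\<^sup>* u z"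
        if "u \<in> antistar T K D" "z \<in> antistar T K D" "\<forall>h. h \<notin> insert g D \<longrightarrow> u h = z h" for u z
      proof -
        have "u h = Zero \<or> u h = T h" "z h = Zero \<or> z h = T h" if "h \<notin> D" for h
          using that \<open>u \<in> _\<close> \<open>z \<in> _\<close> by (auto simp: antistar_def)
        then have "u g = Zero \<or> z g = Zero \<or> u g = z g" using g by metis
        then have "antistar_link T K D u z"
          using that by (auto simp: antistar_link_def le_off_def)
        then show ?thesis by blast
      qed
      note lift = antistar_lift_path[of g K D T, OF g(1,2) Tg less.prems(1)]
      \<comment> \<open>The relaxed path is lifted from both ends. If neither lift arrives, both
        stop at elements vanishing at \<open>g\<close>, which have a common zero.\<close>
      consider w' where "w' \<in> antistar T K D" "\<forall>h. h \<notin> insert g D \<longrightarrow> w' h = y h"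
          "(antistar_link T K D)\<^sup>*\<^sup>* x w'"
        | w' where "w' \<in> antistar T K D" "\<forall>h. h \<notin> insert g D \<longrightarrow> w' h = x h"
          "(antistar_link T K D)\<^sup>*\<^sup>* y w'"
        | p q where "p \<in> antistar T K D" "p g = Zero" "(antistar_link T K D)\<^sup>*\<^sup>* x p"
          "q \<in> antistar T K D" "q g = Zero" "(antistar_link T K D)\<^sup>*\<^sup>* y q"
        using lift[OF less.prems(2) path] lift[OF less.prems(3) antistar_link_sym[OF path]] by blast
      then show ?thesis
      proof cases
        case (1 w')
        then show ?thesis using close[of w' y] less.prems(3) by (meson rtranclp_trans)
      next
        case (2 w')
        then show ?thesis using close[of w' x] less.prems(2) antistar_link_sym by (meson rtranclp_trans)
      next
        case (3 p q)
        then have "(antistar_link T K D)\<^sup>*\<^sup>* p q" using antistar_join g by blast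
        then show ?thesis using 3 antistar_link_sym by (meson rtranclp_trans)
      qed
    qed
  qed
qed

section \<open>The graph of vertices inside a face\<close>

text \<open>Edges come from covectors only, without the added maximum. Every such edge is an edge of
  the cocircuit graph, which is the direction that connectivity needs.\<close>

definition edge :: "('a \<Rightarrow> sign) \<Rightarrow> ('a \<Rightarrow> sign) \<Rightarrow> bool" where
  "edge x y \<longleftrightarrow> x \<noteq> y \<and> (\<exists>Z\<in>L. {w \<in> atoms. sle w Z} = {x, y})"

lemma edge_sym: "edge x y \<Longrightarrow> edge y x"
  by (auto simp: edge_def insert_commute)

definition edge_in :: "('a \<Rightarrow> sign) set \<Rightarrow> ('a \<Rightarrow> sign) \<Rightarrow> ('a \<Rightarrow> sign) \<Rightarrow> bool" where
  "edge_in V x y \<longleftrightarrow> x \<in> V \<and> y \<in> V \<and> edge x y"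

lemma edge_in_mono: "(edge_in V)\<^sup>*\<^sup>* x y \<Longrightarrow> V \<subseteq> W \<Longrightarrow> (edge_in W)\<^sup>*\<^sup>* x y"
  by (rule rtranclp_mono[THEN predicate2D]) (auto simp: edge_in_def)

text \<open>Conformal distinct atoms are neither equal nor opposite, so neither support contains the
  other: one gives the nonzero sign outside \<open>ssupp v\<close>, the other the zero inside
  it.\<close>

lemma atom_below_in_antistar:
  assumes "v \<in> atoms" "x \<in> atoms" "sle v T" "sle x T" "x \<noteq> v"
  shows "x \<in> antistar T (ssupp v) {}"
proof -
  have ne: "x \<noteq> sneg v" "v \<noteq> sneg x"
  proof -
    obtain h where h: "v h \<noteq> Zero" using atomsD(2)[OF assms(1)] unfolding nonzero_ex by blast
    have "v h = T h" "x h = Zero \<or> x h = T h" using assms(3,4) h unfolding sle_def by metis+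
    then have *: "x h \<noteq> flip (v h)" "v h \<noteq> flip (x h)" using h by (metis flip_eq_self(1) flip_flip)+
    show "x \<noteq> sneg v" using *(1) sneg_apply[of v h] by metis
    show "v \<noteq> sneg x" using *(2) sneg_apply[of x h] by metis
  qed
  have nz: "x \<noteq> szero" "v \<noteq> szero" "x \<in> L" "v \<in> L" using atomsD assms(1,2) by auto
  have "\<not> ssupp x \<subseteq> ssupp v" "\<not> ssupp v \<subseteq> ssupp x"
    using atom_ssupp[OF assms(1) nz(3,1)] atom_ssupp[OF assms(2) nz(4,2)] assms(5) ne by auto
  then show ?thesis
    using assms(4) nz(3) unfolding antistar_def sle_def by auto
qed

text \<open>A path of faces in the antistar of \<open>v\<close> is turned into a path of vertices.
  Connectedness of proper faces is a hypothesis so that the statement serves inside the induction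
  for \<open>face_connected\<close> and again after it.\<close>

lemma face_connected_avoiding_step:
  assumes T: "T \<in> L" and v: "v \<in> atoms" "sle v T"
    and x: "x \<in> atoms" "sle x T" "x \<noteq> v" and y: "y \<in> atoms" "sle y T" "y \<noteq> v"
    and faces: "\<And>W a b. W \<in> L \<Longrightarrow> sle W T \<Longrightarrow> W \<noteq> T \<Longrightarrow> a \<in> atoms \<Longrightarrow> sle a W \<Longrightarrow> b \<in> atoms \<Longrightarrow> sle b W \<Longrightarrow>
        (edge_in {w \<in> atoms. sle w W})\<^sup>*\<^sup>* a b"
  shows "(edge_in {w \<in> atoms. sle w T \<and> w \<noteq> v})\<^sup>*\<^sup>* x y"
proof -
  let ?V = "{w \<in> atoms. sle w T \<and> w \<noteq> v}"
  have "(antistar_link T (ssupp v) {})\<^sup>*\<^sup>* x y"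
    using antistar_connected[OF T atomsD(1)[OF v(1)] v(2)] atom_below_in_antistar v x y by blast
  \<comment> \<open>Invariant: all vertices of the current face are reachable. Going up to
    \<open>w2\<close>, some vertex of the old face lies in \<open>w2\<close>, and \<open>w2\<close>
    is a connected proper face all of whose vertices differ from \<open>v\<close>.\<close>
  then have "\<forall>z\<in>atoms. sle z y \<longrightarrow> (edge_in ?V)\<^sup>*\<^sup>* x z"
  proof (induction rule: rtranclp_induct)
    case base
    then show ?case using atomsD x(1) by blast
  next
    case (step w w2)
    have w: "w \<in> antistar T (ssupp v) {}" "w2 \<in> antistar T (ssupp v) {}" "sle w w2 \<or> sle w2 w"
      using step.hyps(2) by (auto simp: antistar_link_def le_off_def sle_def)
    have w2: "w2 \<in> L" "sle w2 T" "w2 \<noteq> T" "\<not> sle v w2"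
      using w(2) v(2) by (auto simp: antistar_def sle_def)
    show ?case
    proof (intro ballI impI)
      fix z assume z: "z \<in> atoms" "sle z w2"
      show "(edge_in ?V)\<^sup>*\<^sup>* x z"
      proof (cases "sle w w2")
        case True
        have "w \<in> L" "w \<noteq> szero" using w(1) by (auto simp: antistar_def nonzero_ex)
        then obtain a where a: "a \<in> atoms" "sle a w" using atom_ex by blast
        have "(edge_in {b \<in> atoms. sle b w2})\<^sup>*\<^sup>* a z"
          using faces[OF w2(1-3) a(1)] a z True sle_trans by blast
        moreover have "{b \<in> atoms. sle b w2} \<subseteq> ?V" using w2 sle_trans by blast
        ultimately have "(edge_in ?V)\<^sup>*\<^sup>* a z" by (rule edge_in_mono)
        then show ?thesis using step.IH a by (meson rtranclp_trans)
      next
        case False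
        then show ?thesis using step.IH w(3) z sle_trans by blast
      qed
    qed
  qed
  then show ?thesis using y by auto
qed

text \<open>Either \<open>x\<close> and \<open>y\<close> are the only vertices of the face, hence an
  edge, or a third vertex is available and the connection is made avoiding it.\<close>

lemma face_connected:
  assumes "T \<in> L" "x \<in> atoms" "sle x T" "y \<in> atoms" "sle y T"
  shows "(edge_in {w \<in> atoms. sle w T})\<^sup>*\<^sup>* x y"
  using assms
proof (induction "card (ssupp T)" arbitrary: T x y rule: less_induct)
  case less
  consider "x = y" | "x \<noteq> y" "{w \<in> atoms. sle w T} = {x, y}"
    | v where "v \<in> atoms" "sle v T" "x \<noteq> v" "y \<noteq> v"
    using less.prems by blast
  then show ?case
  proof cases
    case 2
    then have "edge_in {w \<in> atoms. sle w T} x y" using less.prems by (auto simp: edge_in_def edge_def)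
    then show ?thesis by blast
  next
    case 3
    have "(edge_in {w \<in> atoms. sle w T \<and> w \<noteq> v})\<^sup>*\<^sup>* x y"
    proof (rule face_connected_avoiding_step[OF less.prems(1) 3(1,2) less.prems(2,3) 3(3) less.prems(4,5) 3(4)])
      fix W a b
      assume W: "W \<in> L" "sle W T" "W \<noteq> T" "a \<in> atoms" "sle a W" "b \<in> atoms" "sle b W"
      have "card (ssupp W) < card (ssupp T)"
        using W less.prems(1) finite_L_ssupp sle_ssupp_psubset by (meson psubset_card_mono)
      then show "(edge_in {w \<in> atoms. sle w W})\<^sup>*\<^sup>* a b" using less.hyps W by blast
    qed
    then show ?thesis by (rule edge_in_mono) blast
  qed blast
qed

lemma face_connected_avoiding:
  assumes "T \<in> L" "v \<in> atoms" "sle v T" "x \<in> atoms" "sle x T" "x \<noteq> v" "y \<in> atoms" "sle y T" "y \<noteq> v"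
  shows "(edge_in {w \<in> atoms. sle w T \<and> w \<noteq> v})\<^sup>*\<^sup>* x y"
  by (rule face_connected_avoiding_step[OF assms]) (use face_connected in blast)

end

section \<open>Connectivity of cones\<close>

text \<open>Deleting an edge is no worse than deleting one of its ends, but the end must stay
  reachable. Hence both ends are tried: deleting one connects all the other vertices to a fixed
  third vertex \<open>c\<close>.\<close>

lemma mixed_deletion:
  fixes adj :: "'b \<Rightarrow> 'b \<Rightarrow> bool"
  assumes sym: "\<And>a b. adj a b \<Longrightarrow> adj b a" and irr: "\<And>a. \<not> adj a a"
    and V: "finite V" "k + 2 \<le> card V"
    and conn: "\<And>S x y. S \<subseteq> V \<Longrightarrow> card S \<le> k \<Longrightarrow> x \<in> V - S \<Longrightarrow> y \<in> V - S \<Longrightarrow>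
      (\<lambda>a b. a \<in> V - S \<and> b \<in> V - S \<and> adj a b)\<^sup>*\<^sup>* x y"
    and B: "finite B" "S \<subseteq> V" "card S + card B \<le> k" "x \<in> V - S" "y \<in> V - S"
  shows "(\<lambda>a b. a \<in> V - S \<and> b \<in> V - S \<and> adj a b \<and> {a, b} \<notin> B)\<^sup>*\<^sup>* x y"
  using B
proof (induction B arbitrary: S x y rule: finite_induct)
  case empty
  then show ?case using conn[of S x y] by simp
next
  case (insert \<beta> B)
  let ?R = "\<lambda>S B a b. a \<in> V - S \<and> b \<in> V - S \<and> adj a b \<and> {a, b} \<notin> B"
  have finS: "finite S" using V insert.prems finite_subset by blast
  have le: "card S + card B < k" using insert by simp
  show ?case
  proof (cases "\<exists>a b. \<beta> = {a, b} \<and> a \<noteq> b \<and> a \<in> V - S \<and> b \<in> V - S")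
    case False
    have "(?R S B)\<^sup>*\<^sup>* x y" using insert.IH[of S x y] insert.prems le by simp
    moreover have "?R S B u w \<Longrightarrow> ?R S (insert \<beta> B) u w" for u w
      using False irr by blast
    ultimately show ?thesis using mono_rtranclp[of "?R S B" "?R S (insert \<beta> B)"] by blast
  next
    case True
    then obtain a b where ab: "\<beta> = {a, b}" "a \<noteq> b" "a \<in> V - S" "b \<in> V - S" by blast
    have avoid: "(?R S (insert \<beta> B))\<^sup>*\<^sup>* u w"
      if c: "c \<in> \<beta>" and u: "u \<in> V - S" "u \<noteq> c" and w: "w \<in> V - S" "w \<noteq> c" for c u w
    proof -
      have "c \<in> V - S" using c ab by auto
      then have "(?R (insert c S) B)\<^sup>*\<^sup>* u w"
        using insert.IH[of "insert c S" u w] insert.prems(1) le u w finS by auto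
      moreover have "?R (insert c S) B p q \<Longrightarrow> ?R S (insert \<beta> B) p q" for p q
        using c by blast
      ultimately show ?thesis
        using mono_rtranclp[of "?R (insert c S) B" "?R S (insert \<beta> B)"] by blast
    qed
    \<comment> \<open>Since \<open>card S < k\<close>, at most k + 1 vertices are excluded, and
      \<open>V\<close> has at least k + 2.\<close>
    have "card (insert a (insert b S)) < card V"
      using le V(2) finS by (auto simp: card_insert_if)
    then have "\<not> V \<subseteq> insert a (insert b S)"
      using finS card_mono[of "insert a (insert b S)" V] by auto
    then obtain c where c: "c \<in> V - S" "c \<noteq> a" "c \<noteq> b" by blast
    have "(?R S (insert \<beta> B))\<^sup>*\<^sup>* u c \<and> (?R S (insert \<beta> B))\<^sup>*\<^sup>* c u" if u: "u \<in> V - S" for u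
    proof (cases "u = a")
      case True
      then show ?thesis using avoid[of b u c] avoid[of b c u] ab c u by auto
    next
      case False
      then show ?thesis using avoid[of a u c] avoid[of a c u] ab c u by auto
    qed
    then show ?thesis using insert.prems rtranclp_trans by meson
  qed
qed

section \<open>Rank and minors\<close>

text \<open>A lower bound for the matroid rank, witnessed by contracting \<open>m\<close> elements
  in turn, each of them not a loop at its stage. No chain of covectors is mentioned, which makes the
  bound easy to carry to minors.\<close>

fun rank_ge :: "('a \<Rightarrow> sign) set \<Rightarrow> nat \<Rightarrow> bool" where
  "rank_ge L 0 \<longleftrightarrow> True"
| "rank_ge L (Suc m) \<longleftrightarrow> (\<exists>e. (\<exists>Z\<in>L. Z e \<noteq> Zero) \<and> rank_ge {W \<in> L. W e = Zero} m)"

lemma rank_ge_mono: "rank_ge L m \<Longrightarrow> L \<subseteq> L' \<Longrightarrow> rank_ge L' m"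
proof (induction m arbitrary: L L')
  case (Suc m)
  then obtain e Z where e: "Z \<in> L" "Z e \<noteq> Zero" "rank_ge {W \<in> L. W e = Zero} m" by auto
  have "{W \<in> L. W e = Zero} \<subseteq> {W \<in> L'. W e = Zero}" using Suc.prems(2) by blast
  with e(3) have "rank_ge {W \<in> L'. W e = Zero} m" by (rule Suc.IH)
  moreover have "Z \<in> L'" using e(1) Suc.prems(2) by blast
  ultimately show ?case using e(2) unfolding rank_ge.simps by blast
qed simp

text \<open>On covectors this is deletion of the support of \<open>v\<close>, with deleted elements
  turned into loops so that type and ground set stay the same. It describes the faces containing
  \<open>v\<close>: \<open>away v W\<close> stands for the face \<open>scirc v W\<close>.\<close>

definition away :: "('a \<Rightarrow> sign) \<Rightarrow> ('a \<Rightarrow> sign) \<Rightarrow> 'a \<Rightarrow> sign" where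
  "away v W = (\<lambda>e. if v e = Zero then W e else Zero)"

lemma away_apply: "away v W e = (if v e = Zero then W e else Zero)"
  by (simp add: away_def)

lemma scirc_away [simp]: "scirc v (away v W) = scirc v W"
  by (auto simp: scirc_def away_def)

lemma sle_away: "sle z (scirc v W) \<Longrightarrow> sle (away v z) W"
  unfolding sle_def away_apply scirc_apply by metis

lemma sle_lift: "sle X Y \<Longrightarrow> sle (scirc v X) (scirc v Y)"
  unfolding sle_def scirc_apply by metis

context covector_system
begin

lemma away_system: "covector_system E (away v ` L)"
proof
  fix X assume "X \<in> away v ` L"
  then obtain W where W: "W \<in> L" "X = away v W" by blast
  have "ssupp X \<subseteq> ssupp W" using W by (auto simp: away_apply split: if_splits)
  then show "ssupp X \<subseteq> E" using L_ssupp W by blast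
  have "sneg X = away v (sneg W)" using W by (auto simp: sneg_def away_def)
  then show "sneg X \<in> away v ` L" using L_neg W by blast
next
  have "szero = away v szero" by (auto simp: away_def szero_def)
  then show "szero \<in> away v ` L" using L_zero by blast
next
  fix X Y assume "X \<in> away v ` L" "Y \<in> away v ` L"
  then obtain X' Y' where *: "X' \<in> L" "X = away v X'" "Y' \<in> L" "Y = away v Y'" by blast
  then have "scirc X Y = away v (scirc X' Y')" by (auto simp: scirc_def away_def)
  then show "scirc X Y \<in> away v ` L" using L_circ * by blast
  fix e assume e: "e \<in> ssep X Y"
  then have "e \<in> ssep X' Y'" using * by (auto simp: mem_ssep away_apply split: if_splits)
  then obtain Z where Z: "Z \<in> L" "Z e = Zero" "\<forall>f. f \<notin> ssep X' Y' \<longrightarrow> Z f = scirc X' Y' f"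
    using L_elim * by blast
  have "away v Z f = scirc X Y f" if "f \<notin> ssep X Y" for f
  proof (cases "v f = Zero")
    case True
    then have "f \<notin> ssep X' Y'" using that * by (auto simp: mem_ssep away_apply)
    then show ?thesis using Z True * by (simp add: away_apply scirc_apply)
  qed (use * in \<open>simp add: away_apply scirc_apply\<close>)
  then show "\<exists>Z\<in>away v ` L. Z e = Zero \<and> (\<forall>f. f \<notin> ssep X Y \<longrightarrow> Z f = scirc X Y f)"
    using Z by (intro bexI[of _ "away v Z"]) (auto simp: away_apply)
qed (rule finite_ground)

text \<open>The covectors of the contraction of \<open>e\<close>, with \<open>e\<close> kept as a
  loop.\<close>

lemma contraction_system: "covector_system E {W \<in> L. W e = Zero}"
proof
  fix X Y f
  assume XY: "X \<in> {W \<in> L. W e = Zero}" "Y \<in> {W \<in> L. W e = Zero}" "f \<in> ssep X Y"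
  then obtain Z where Z: "Z \<in> L" "Z f = Zero" "\<forall>f. f \<notin> ssep X Y \<longrightarrow> Z f = scirc X Y f"
    using L_elim by blast
  have "e \<notin> ssep X Y" "scirc X Y e = Zero" using XY by (auto simp: mem_ssep scirc_apply)
  then have "Z e = Zero" using Z by metis
  then show "\<exists>Z\<in>{W \<in> L. W e = Zero}. Z f = Zero \<and> (\<forall>f. f \<notin> ssep X Y \<longrightarrow> Z f = scirc X Y f)"
    using Z by blast
qed (use finite_ground L_ssupp L_zero L_neg L_circ in \<open>auto simp: scirc_apply\<close>)

text \<open>The covectors after contraction of everything outside \<open>F\<close>.\<close>

lemma subspace_system: "covector_system E {W \<in> L. ssupp W \<subseteq> F}"
proof
  fix X Y f
  assume XY: "X \<in> {W \<in> L. ssupp W \<subseteq> F}" "Y \<in> {W \<in> L. ssupp W \<subseteq> F}" "f \<in> ssep X Y"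
  then obtain Z where Z: "Z \<in> L" "Z f = Zero" "\<forall>f. f \<notin> ssep X Y \<longrightarrow> Z f = scirc X Y f"
    using L_elim by blast
  have "ssupp Z \<subseteq> F"
  proof
    fix e assume e: "e \<in> ssupp Z"
    show "e \<in> F"
    proof (rule ccontr)
      assume "e \<notin> F"
      then have "X e = Zero" "Y e = Zero" using XY by auto
      then have "e \<notin> ssep X Y" "scirc X Y e = Zero" by (auto simp: mem_ssep scirc_apply)
      then show False using Z(3) e by (metis mem_ssupp)
    qed
  qed
  then show "\<exists>Z\<in>{W \<in> L. ssupp W \<subseteq> F}. Z f = Zero \<and> (\<forall>f. f \<notin> ssep X Y \<longrightarrow> Z f = scirc X Y f)"
    using Z by blast
next
  fix X Y assume XY: "X \<in> {W \<in> L. ssupp W \<subseteq> F}" "Y \<in> {W \<in> L. ssupp W \<subseteq> F}"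
  have "ssupp (scirc X Y) \<subseteq> ssupp X \<union> ssupp Y" by (auto simp: scirc_apply)
  then show "scirc X Y \<in> {W \<in> L. ssupp W \<subseteq> F}" using XY L_circ by blast
next
  show "szero \<in> {W \<in> L. ssupp W \<subseteq> F}" using L_zero by auto
next
  fix X assume X: "X \<in> {W \<in> L. ssupp W \<subseteq> F}"
  have "ssupp (sneg X) = ssupp X" by auto
  then show "sneg X \<in> {W \<in> L. ssupp W \<subseteq> F}" using X L_neg by auto
qed (use finite_ground L_ssupp in auto)

text \<open>After replacing \<open>Z\<close> by its negative if necessary, \<open>Y\<close> and
  \<open>Z\<close> are separated at \<open>f\<close>; eliminating \<open>f\<close> keeps
  \<open>Z e\<close> because \<open>Y e = Zero\<close>. It says that if \<open>f\<close> survives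
  contraction of \<open>e\<close>, then \<open>e\<close> survives contraction of
  \<open>f\<close>.\<close>

lemma exchange:
  assumes "Y \<in> L" "Z \<in> L" "Y f \<noteq> Zero" "Z f \<noteq> Zero" "Y e = Zero" "Z e \<noteq> Zero"
  shows "\<exists>W\<in>L. W f = Zero \<and> W e \<noteq> Zero"
proof -
  have "\<exists>Z'\<in>L. f \<in> ssep Y Z' \<and> Z' e \<noteq> Zero"
  proof (cases "Z f = flip (Y f)")
    case True
    then show ?thesis using assms by (auto simp: mem_ssep)
  next
    case False
    then have "Z f = Y f" using assms sign_cases2[of "Y f" "Z f"] by auto
    then have "f \<in> ssep Y (sneg Z)" using assms by (simp add: mem_ssep)
    then show ?thesis using L_neg[OF assms(2)] assms(6) by (intro bexI[of _ "sneg Z"]) auto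
  qed
  then obtain Z' where Z': "Z' \<in> L" "f \<in> ssep Y Z'" "Z' e \<noteq> Zero" by blast
  then obtain W where W: "W \<in> L" "W f = Zero" "\<forall>h. h \<notin> ssep Y Z' \<longrightarrow> W h = scirc Y Z' h"
    using L_elim assms(1) by blast
  have "e \<notin> ssep Y Z'" "scirc Y Z' e = Z' e" using assms(5) by (auto simp: mem_ssep scirc_apply)
  then show ?thesis using W Z'(3) by metis
qed

end

text \<open>The definition provides only some \<open>e\<close> whose contraction costs one rank;
  here any non-loop \<open>f\<close> will do. If \<open>f\<close> is still a non-loop after
  contracting \<open>e\<close>, the two contractions commute; otherwise \<open>e\<close> and
  \<open>f\<close> are parallel and their contractions coincide.\<close>

lemma rank_ge_contract:
  assumes "covector_system E L" "rank_ge L (Suc m)" "Z \<in> L" "Z f \<noteq> Zero"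
  shows "rank_ge {W \<in> L. W f = Zero} m"
  using assms
proof (induction m arbitrary: L Z)
  case (Suc m)
  interpret covector_system E L by fact
  obtain e Z0 where e: "Z0 \<in> L" "Z0 e \<noteq> Zero" "rank_ge {W \<in> L. W e = Zero} (Suc m)"
    using Suc.prems(2) rank_ge.simps(2)[of L "Suc m"] by blast
  show ?case
  proof (cases "\<exists>Y\<in>L. Y e = Zero \<and> Y f \<noteq> Zero")
    case True
    then obtain Y where Y: "Y \<in> L" "Y e = Zero" "Y f \<noteq> Zero" by blast
    have "rank_ge {W \<in> {W \<in> L. W e = Zero}. W f = Zero} m"
      using Suc.IH[OF contraction_system e(3), of Y] Y by blast
    moreover have "{W \<in> {W \<in> L. W e = Zero}. W f = Zero} = {W \<in> {W \<in> L. W f = Zero}. W e = Zero}"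
      by blast
    moreover have "\<exists>W\<in>L. W f = Zero \<and> W e \<noteq> Zero"
      using exchange[OF Y(1) e(1), of f e] Y e by (cases "Z0 f = Zero") auto
    ultimately show ?thesis by auto
  next
    case False
    have "W e = Zero" if "W \<in> L" "W f = Zero" for W
    proof (rule ccontr)
      assume "W e \<noteq> Zero"
      moreover have "Z e \<noteq> Zero" using False Suc.prems(3,4) by blast
      ultimately show False using exchange[OF that(1) Suc.prems(3), of e f] that Suc.prems(4) False by blast
    qed
    then have "{W \<in> L. W f = Zero} = {W \<in> L. W e = Zero}" using False by blast
    then show ?thesis using e(3) by simp
  qed
qed simp

text \<open>The zero set of an atom is a hyperplane, so restriction to it costs exactly one rank.
  For the lower bound a non-loop \<open>f\<close> in the zero set is contracted: \<open>v\<close>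
  remains an atom, and contraction of \<open>f\<close> commutes with \<open>away v\<close>.\<close>

lemma rank_ge_away:
  assumes "covector_system E L" "rank_ge L (Suc m)" "v \<in> covector_system.atoms L"
  shows "rank_ge (away v ` L) m"
  using assms
proof (induction m arbitrary: L)
  case (Suc m)
  interpret covector_system E L by fact
  have v: "v \<in> L" "v \<noteq> szero" using atomsD Suc.prems(3) by auto
  \<comment> \<open>Otherwise every covector is supported inside \<open>v\<close>, so only zero,
    \<open>v\<close> and \<open>sneg v\<close> exist, and contracting one non-loop leaves
    nothing.\<close>
  have "\<exists>f. v f = Zero \<and> (\<exists>W\<in>L. W f \<noteq> Zero)"
  proof (rule ccontr)
    assume *: "\<not> ?thesis"
    have all: "W \<in> {szero, v, sneg v}" if "W \<in> L" for W
    proof -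
      have "ssupp W \<subseteq> ssupp v" using * that by auto
      then show ?thesis using atom_ssupp[OF Suc.prems(3) that] by blast
    qed
    obtain e where e: "\<exists>Z\<in>L. Z e \<noteq> Zero" "rank_ge {W \<in> L. W e = Zero} (Suc m)"
      using Suc.prems(2) rank_ge.simps(2)[of L "Suc m"] by blast
    obtain g Y where Y: "Y \<in> L" "Y e = Zero" "Y g \<noteq> Zero" using e(2) by auto
    have "v e \<noteq> Zero" using e(1) * by blast
    then show False using all[OF Y(1)] Y(2,3) by auto
  qed
  then obtain f W where f: "v f = Zero" "W \<in> L" "W f \<noteq> Zero" by blast
  let ?L = "{W \<in> L. W f = Zero}"
  interpret F: covector_system E ?L by (rule contraction_system)
  have "v \<in> F.atoms" using Suc.prems(3) f(1) by (auto simp: F.atoms_def atoms_def)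
  moreover have "rank_ge ?L (Suc m)" using rank_ge_contract[OF Suc.prems(1,2) f(2,3)] .
  ultimately have "rank_ge (away v ` ?L) m" using Suc.IH contraction_system by blast
  moreover have "away v ` ?L = {W \<in> away v ` L. W f = Zero}"
    using f(1) by (auto simp: away_apply)
  moreover have "\<exists>Z\<in>away v ` L. Z f \<noteq> Zero" using f by (auto simp: away_apply)
  ultimately show ?case by auto
qed simp

section \<open>Cones and their vertices\<close>

definition in_cone :: "('a \<Rightarrow> sign set) \<Rightarrow> ('a \<Rightarrow> sign) \<Rightarrow> bool" where
  "in_cone A W \<longleftrightarrow> (\<forall>e. W e = Zero \<or> W e \<in> A e)"

lemma in_cone_sle: "in_cone A W \<Longrightarrow> sle Z W \<Longrightarrow> in_cone A Z"
  unfolding in_cone_def sle_def by metis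

lemma in_cone_scirc: "in_cone A W \<Longrightarrow> in_cone A Z \<Longrightarrow> in_cone A (scirc W Z)"
  unfolding in_cone_def scirc_apply by metis

lemma in_cone_away: "in_cone A W \<Longrightarrow> in_cone A (away v W)"
  unfolding in_cone_def away_apply by metis

context covector_system
begin

definition cone_atoms :: "('a \<Rightarrow> sign set) \<Rightarrow> ('a \<Rightarrow> sign) set" where
  "cone_atoms A = {z \<in> atoms. in_cone A z}"

lemma finite_cone_atoms: "finite (cone_atoms A)"
  using finite_atoms by (simp add: cone_atoms_def)

text \<open>Conformal vertices are joined within the face spanned by their composition. Otherwise
  elimination at \<open>e\<close> produces a vertex \<open>z\<close> between \<open>x\<close> and
  \<open>y\<close> with smaller separators to both; \<open>z e = Zero\<close> also rules out that
  \<open>z\<close> is opposite to one of them.\<close>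

lemma cone_path:
  assumes "x \<in> cone_atoms A" "y \<in> cone_atoms A" "y \<noteq> sneg x"
  shows "(edge_in (cone_atoms A))\<^sup>*\<^sup>* x y"
  using assms
proof (induction "card (ssep x y)" arbitrary: x y rule: less_induct)
  case less
  have x: "x \<in> atoms" "in_cone A x" "x \<in> L" "x \<noteq> szero" and y: "y \<in> atoms" "in_cone A y" "y \<in> L" "y \<noteq> szero"
    using less.prems atomsD by (auto simp: cone_atoms_def)
  show ?case
  proof (cases "ssep x y = {}")
    case True
    have "sle y (scirc x y)" using True by (rule scirc_conformal_ge)
    then have "(edge_in {w \<in> atoms. sle w (scirc x y)})\<^sup>*\<^sup>* x y"
      using face_connected[OF L_circ[OF x(3) y(3)]] x y by simp
    moreover have "{w \<in> atoms. sle w (scirc x y)} \<subseteq> cone_atoms A"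
      using in_cone_sle in_cone_scirc x(2) y(2) unfolding cone_atoms_def by blast
    ultimately show ?thesis by (rule edge_in_mono)
  next
    case False
    then obtain e where e: "e \<in> ssep x y" by blast
    then obtain W where W: "W \<in> L" "W e = Zero" "\<forall>f. f \<notin> ssep x y \<longrightarrow> W f = scirc x y f"
      using L_elim x(3) y(3) by blast
    have xe: "x e \<noteq> Zero" "y e \<noteq> Zero" using e by (auto simp: mem_ssep)
    have sep: "W f = Zero \<or> W f = x f \<or> W f = y f" for f
    proof (cases "f \<in> ssep x y")
      case True
      then show ?thesis using sign_cases2[of "x f" "W f"] by (auto simp: mem_ssep)
    next
      case False
      then show ?thesis using W(3) by (auto simp: scirc_apply)
    qed
    \<comment> \<open>A zero result would mean that every coordinate is cancelled, so
      \<open>y\<close> would be opposite to \<open>x\<close>; this is where the hypothesis on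
      \<open>y\<close> enters.\<close>
    have "W \<noteq> szero"
    proof
      assume W0: "W = szero"
      have "y f = flip (x f)" for f
      proof (cases "f \<in> ssep x y")
        case False
        then have "scirc x y f = Zero" using W(3) W0 by (metis szero_apply)
        then show ?thesis by (auto simp: scirc_apply split: if_splits)
      qed (simp add: mem_ssep)
      then show False using less.prems(3) by (auto simp: sneg_def)
    qed
    then obtain z where z: "z \<in> atoms" "sle z W" using atom_ex W(1) by blast
    have zs: "z f = Zero \<or> z f = x f \<or> z f = y f" for f
      using sep[of f] z(2) unfolding sle_def by metis
    have ze: "z e = Zero" using z(2) W(2) unfolding sle_def by metis
    have zh: "z \<in> cone_atoms A"
      unfolding cone_atoms_def using z(1) zs x(2) y(2) unfolding in_cone_def by auto metis+
    have "ssep x z \<subset> ssep x y"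
    proof
      show "ssep x z \<subseteq> ssep x y"
      proof
        fix f assume "f \<in> ssep x z"
        then have "x f \<noteq> Zero" "z f = flip (x f)" by (auto simp: mem_ssep)
        then show "f \<in> ssep x y" using zs[of f] by (auto simp: mem_ssep)
      qed
      have "e \<notin> ssep x z" using ze xe by (simp add: mem_ssep)
      then show "ssep x z \<noteq> ssep x y" using e by blast
    qed
    then have 1: "card (ssep x z) < card (ssep x y)" using finite_ssep[OF x(3)] by (meson psubset_card_mono)
    have "ssep z y \<subset> ssep x y"
    proof
      show "ssep z y \<subseteq> ssep x y"
      proof
        fix f assume "f \<in> ssep z y"
        then have "z f \<noteq> Zero" "y f = flip (z f)" by (auto simp: mem_ssep)
        then show "f \<in> ssep x y" using zs[of f] by (auto simp: mem_ssep)
      qed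
      have "e \<notin> ssep z y" using ze by (simp add: mem_ssep)
      then show "ssep z y \<noteq> ssep x y" using e by blast
    qed
    then have 2: "card (ssep z y) < card (ssep x y)" using finite_ssep[OF x(3)] by (meson psubset_card_mono)
    have "z \<noteq> sneg x" "y \<noteq> sneg z" using ze xe flip_eq_Zero(1) sneg_apply by metis+
    then show ?thesis using less.hyps[OF 1 less.prems(1) zh] less.hyps[OF 2 zh less.prems(2)]
      by (meson rtranclp_trans)
  qed
qed

text \<open>Opposite vertices are joined through a third one. If the cone had only \<open>x\<close>
  and \<open>sneg x\<close>, the vertices below \<open>U\<close> would force the support of
  \<open>U\<close>, hence of all covectors, into that of \<open>x\<close>, leaving rank at most
  1.\<close>

lemma cone_connected_rank2:
  assumes U: "U \<in> L" "in_cone A U" "\<forall>W\<in>L. ssupp W \<subseteq> ssupp U" and r: "rank_ge L 2"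
    and x: "x \<in> cone_atoms A" and y: "y \<in> cone_atoms A"
  shows "(edge_in (cone_atoms A))\<^sup>*\<^sup>* x y"
proof (cases "y = sneg x")
  case False
  then show ?thesis using cone_path x y by blast
next
  case True
  have xa: "x \<in> atoms" using x by (simp add: cone_atoms_def)
  have "\<exists>z\<in>cone_atoms A. z \<noteq> x \<and> z \<noteq> sneg x"
  proof (rule ccontr)
    assume *: "\<not> ?thesis"
    have "ssupp U \<subseteq> ssupp x"
    proof
      fix e assume "e \<in> ssupp U"
      then obtain z where z: "z \<in> atoms" "sle z U" "z e \<noteq> Zero" using atom_below U(1) by auto
      then have "z \<in> cone_atoms A" using U(2) in_cone_sle by (auto simp: cone_atoms_def)
      then have "z = x \<or> z = sneg x" using * by blast
      then show "e \<in> ssupp x" using z(3) by auto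
    qed
    then have all: "W \<in> {szero, x, sneg x}" if "W \<in> L" for W
      using atom_ssupp[OF xa that] U(3) that by blast
    obtain e where e: "\<exists>Z\<in>L. Z e \<noteq> Zero" "rank_ge {W \<in> L. W e = Zero} 1"
      using r by (auto simp: numeral_2_eq_2)
    obtain g Y where Y: "Y \<in> L" "Y e = Zero" "Y g \<noteq> Zero" using e(2) by auto
    have "x e \<noteq> Zero" using e(1) all by fastforce
    then show False using all[OF Y(1)] Y(2,3) by auto
  qed
  then obtain z where z: "z \<in> cone_atoms A" "z \<noteq> x" "z \<noteq> sneg x" by blast
  have "y \<noteq> sneg z" using True z(2) sneg_sneg by metis
  then show ?thesis using cone_path[OF x z(1,3)] cone_path[OF z(1) y] by (meson rtranclp_trans)
qed

lemma away_nonzero: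
  assumes "v \<in> atoms" "z \<in> atoms" "z \<noteq> v" "ssep z v = {}"
  shows "away v z \<noteq> szero"
proof
  assume *: "away v z = szero"
  have "ssupp z \<subseteq> ssupp v"
  proof
    fix e assume "e \<in> ssupp z"
    then show "e \<in> ssupp v" using * by (metis away_apply mem_ssupp szero_apply)
  qed
  then have "z = v \<or> z = sneg v" using atom_ssupp[OF assms(1)] assms(2) atomsD by blast
  then have "z = sneg v" using assms(3) by blast
  moreover obtain h where "v h \<noteq> Zero" using atomsD(2)[OF assms(1)] unfolding nonzero_ex by blast
  ultimately have "h \<in> ssep z v" by (auto simp: mem_ssep)
  then show False using assms(4) by blast
qed

end

text \<open>A face with full support has at least as many vertices as its rank. Each vertex of
  \<open>away v U\<close> is the image of a vertex of \<open>U\<close> other than \<open>v\<close>,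
  so \<open>v\<close> itself adds one to the inductive count.\<close>

lemma card_atoms_below:
  assumes "covector_system E L" "U \<in> L" "\<forall>W\<in>L. ssupp W \<subseteq> ssupp U" "rank_ge L m"
  shows "m \<le> card {w \<in> covector_system.atoms L. sle w U}"
  using assms
proof (induction m arbitrary: L U)
  case (Suc m)
  interpret covector_system E L by fact
  let ?B = "{w \<in> atoms. sle w U}"
  have "\<exists>Z\<in>L. \<exists>e. Z e \<noteq> Zero" using Suc.prems(4) by auto
  then obtain e where "U e \<noteq> Zero" using Suc.prems(3) by fastforce
  then obtain v where v: "v \<in> atoms" "sle v U" using atom_below[OF Suc.prems(2)] by blast
  interpret V: covector_system E "away v ` L" by (rule away_system)
  have vU: "scirc v U = U" using v(2) unfolding sle_def scirc_def by (intro ext) metis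
  have "\<forall>W\<in>away v ` L. ssupp W \<subseteq> ssupp (away v U)"
    using Suc.prems(3) by (auto simp: away_apply subset_iff)
  then have "m \<le> card {w \<in> V.atoms. sle w (away v U)}"
    using Suc.IH[OF away_system _ _ rank_ge_away[OF Suc.prems(1,4) v(1)], of "away v U"] Suc.prems(2) by blast
  also have "\<dots> \<le> card (away v ` (?B - {v}))"
  proof (rule card_mono)
    show "finite (away v ` (?B - {v}))" using finite_atoms by simp
    show "{w \<in> V.atoms. sle w (away v U)} \<subseteq> away v ` (?B - {v})"
    proof
      fix w assume "w \<in> {w \<in> V.atoms. sle w (away v U)}"
      then have w: "w \<in> V.atoms" "sle w (away v U)" by auto
      obtain W where W: "W \<in> L" "w = away v W" using V.atomsD(1)[OF w(1)] by blast
      obtain e where e: "w e \<noteq> Zero" using V.atomsD(2)[OF w(1)] unfolding nonzero_ex by blast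
      then have ve: "v e = Zero" "scirc v W e \<noteq> Zero" using W by (auto simp: away_apply scirc_apply split: if_splits)
      then obtain z where z: "z \<in> atoms" "sle z (scirc v W)" "z e \<noteq> Zero"
        using atom_below L_circ[OF atomsD(1)[OF v(1)] W(1)] by blast
      have "sle (away v z) w" using sle_away[of z v w] z(2) W(2) by simp
      moreover have "away v z \<noteq> szero" using z(3) ve by (metis away_apply szero_apply)
      ultimately have "away v z = w" using V.atomsD(3)[OF w(1)] z(1) atomsD(1) by blast
      moreover have "sle (scirc v w) (scirc v (away v U))"
        using w(2) unfolding sle_def scirc_apply by metis
      then have "sle z U" using z(2) W(2) vU sle_trans by (metis scirc_away)
      moreover have "z \<noteq> v" using z(3) ve by auto
      ultimately show "w \<in> away v ` (?B - {v})" using z(1) by blast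
    qed
  qed
  also have "\<dots> \<le> card (?B - {v})" using finite_atoms by (intro card_image_le) auto
  finally have "m \<le> card (?B - {v})" .
  moreover have "card (?B - {v}) < card ?B" using v finite_atoms by (intro psubset_card_mono) auto
  ultimately show ?case by simp
qed simp

context covector_system
begin

text \<open>A vertex \<open>v\<close> of a path can be bypassed inside the faces around it: the faces containing \<open>v\<close>
  form the covector system \<open>away v ` L\<close> of smaller rank, and a deleted vertex \<open>s\<close> other than \<open>v\<close>
  obstructs there only the single face \<open>away v s\<close>, which is either a vertex or possibly an edge.\<close>

lemma bypass:
  assumes v: "v \<in> cone_atoms A" and S: "S \<subseteq> cone_atoms A" "v \<notin> S" "card S + 2 \<le> m"
    and a: "a \<in> cone_atoms A - S" "edge a v" and b: "b \<in> cone_atoms A - S" "edge b v"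
    and V_card: "m \<le> card (covector_system.cone_atoms (away v ` L) A)"
    and V_conn: "\<And>S x y. S \<subseteq> covector_system.cone_atoms (away v ` L) A \<Longrightarrow> card S + 2 \<le> m \<Longrightarrow>
      x \<in> covector_system.cone_atoms (away v ` L) A - S \<Longrightarrow> y \<in> covector_system.cone_atoms (away v ` L) A - S \<Longrightarrow>
      (covector_system.edge_in (away v ` L) (covector_system.cone_atoms (away v ` L) A - S))\<^sup>*\<^sup>* x y"
  shows "(edge_in (cone_atoms A - insert v S))\<^sup>*\<^sup>* a b"
proof -
  interpret V: covector_system E "away v ` L" by (rule away_system)
  have va: "v \<in> atoms" "v \<in> L" "in_cone A v" using v atomsD by (auto simp: cone_atoms_def)
  have finS: "finite S" using S(1) finite_cone_atoms finite_subset by blast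
  have SA: "S \<subseteq> atoms" using S(1) by (auto simp: cone_atoms_def)
  \<comment> \<open>Only deleted vertices conformal with \<open>v\<close> lie in a common face with
    \<open>v\<close>, so only these matter.\<close>
  define block where "block = away v ` {s \<in> S. ssep s v = {}}"
  define BV where "BV = block \<inter> V.atoms"
  \<comment> \<open>A blocking face that is not a vertex is recorded by its set of vertices. Such a
    set deletes an edge exactly when it is the pair of ends of that edge, and nothing
    otherwise.\<close>
  define BE where "BE = (\<lambda>W. {c \<in> V.atoms. sle c W}) ` (block - V.atoms)"
  have finb: "finite block" using finS by (simp add: block_def)
  have "card block \<le> card {s \<in> S. ssep s v = {}}" unfolding block_def using finS by (intro card_image_le) auto
  also have "\<dots> \<le> card S" using finS by (intro card_mono) auto
  finally have "card block \<le> card S" .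
  moreover have "card BV + card (block - V.atoms) = card block"
  proof -
    have "card (BV \<union> (block - V.atoms)) = card BV + card (block - V.atoms)"
      unfolding BV_def using finb by (intro card_Un_disjoint) auto
    moreover have "BV \<union> (block - V.atoms) = block" by (auto simp: BV_def)
    ultimately show ?thesis by simp
  qed
  moreover have "card BE \<le> card (block - V.atoms)" unfolding BE_def using finb by (intro card_image_le) auto
  ultimately have card_B: "card BV + card BE \<le> m - 2" using S(3) by linarith
  have BVsub: "BV \<subseteq> V.cone_atoms A"
  proof
    fix w assume "w \<in> BV"
    then obtain s where "s \<in> S" "w = away v s" "w \<in> V.atoms" by (auto simp: BV_def block_def)
    then show "w \<in> V.cone_atoms A" using S(1) in_cone_away
      by (auto simp: V.cone_atoms_def cone_atoms_def)
  qed
  \<comment> \<open>An edge from \<open>v\<close> to \<open>z\<close> is a vertex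
    \<open>away v z\<close> of the structure around \<open>v\<close>, because its face contains no
    vertices but \<open>v\<close> and \<open>z\<close>. It is not blocked, since a deleted vertex
    blocking it would lie on the same edge.\<close>
  have neighbour: "away v z \<in> V.cone_atoms A - BV \<and> {w \<in> atoms. sle w (scirc v z)} = {z, v}"
    if z: "z \<in> cone_atoms A - S" "edge z v" for z
  proof -
    have za: "z \<in> atoms" "z \<in> L" "in_cone A z" using z atomsD by (auto simp: cone_atoms_def)
    obtain Z where Z: "Z \<in> L" "{w \<in> atoms. sle w Z} = {z, v}" and zv: "z \<noteq> v"
      using z(2) by (auto simp: edge_def)
    have le: "sle z Z" "sle v Z" using Z(2) by blast+
    then have conf: "ssep v z = {}" "ssep z v = {}" using ssep_conformal by blast+
    have below: "{w \<in> atoms. sle w (scirc v z)} = {z, v}"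
    proof
      show "{w \<in> atoms. sle w (scirc v z)} \<subseteq> {z, v}"
        using Z(2) scirc_least[OF le(2,1)] sle_trans by blast
      show "{z, v} \<subseteq> {w \<in> atoms. sle w (scirc v z)}"
        using za va scirc_conformal_ge[OF conf(1)] by auto
    qed
    have nz: "away v z \<noteq> szero" using away_nonzero[OF va(1) za(1) zv conf(2)] .
    have "Y = away v z" if Y: "Y \<in> away v ` L" "Y \<noteq> szero" "sle Y (away v z)" for Y
    proof -
      obtain W where W: "W \<in> L" "Y = away v W" using Y by blast
      obtain e where e: "Y e \<noteq> Zero" using Y(2) unfolding nonzero_ex by blast
      then have ve: "v e = Zero" "scirc v W e \<noteq> Zero"
        using W by (auto simp: away_apply scirc_apply split: if_splits)
      then obtain u where u: "u \<in> atoms" "sle u (scirc v W)" "u e \<noteq> Zero"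
        using atom_below L_circ[OF va(2) W(1)] by blast
      have "sle (scirc v Y) (scirc v (away v z))" using Y(3) by (rule sle_lift)
      then have "sle u (scirc v z)" using u(2) W(2) sle_trans by simp
      then have "u = z" using below u(1,3) ve(1) by auto
      then have "sle (away v z) Y" using sle_away[of z v Y] u(2) W(2) by simp
      then show ?thesis using Y(3) sle_antisym by blast
    qed
    then have "away v z \<in> V.atoms" using nz za(2) by (auto simp: V.atoms_def)
    moreover have "away v z \<notin> BV"
    proof
      assume "away v z \<in> BV"
      then obtain s where s: "s \<in> S" "ssep s v = {}" "away v z = away v s"
        by (auto simp: BV_def block_def)
      have "sle s (scirc v s)" using s(2) ssep_commute scirc_conformal_ge by metis
      then have "sle s (scirc v z)" using s(3) by (metis scirc_away)
      then have "s = z \<or> s = v" using below s(1) SA by blast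
      then show False using s(1) S(2) z(1) by blast
    qed
    ultimately show ?thesis using below in_cone_away za(3) by (auto simp: V.cone_atoms_def)
  qed
  let ?W = "cone_atoms A - insert v S"
  let ?R = "\<lambda>x y. x \<in> V.cone_atoms A - BV \<and> y \<in> V.cone_atoms A - BV \<and> V.edge x y \<and> {x, y} \<notin> BE"
  have path: "?R\<^sup>*\<^sup>* (away v a) (away v b)"
  \<comment> \<open>The structure around \<open>v\<close> tolerates m - 2 deleted vertices and has
    at least m vertices, hence this value of \<open>k\<close>.\<close>
  proof (rule mixed_deletion[where k = "m - 2"])
    show "\<And>x y. V.edge x y \<Longrightarrow> V.edge y x" by (rule V.edge_sym)
    show "\<And>x. \<not> V.edge x x" by (simp add: V.edge_def)
    show "BV \<subseteq> V.cone_atoms A" by (rule BVsub)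
    show "card BV + card BE \<le> m - 2" by (rule card_B)
    show "away v a \<in> V.cone_atoms A - BV" using neighbour[OF a] by blast
    show "away v b \<in> V.cone_atoms A - BV" using neighbour[OF b] by blast
    show "finite (V.cone_atoms A)" by (rule V.finite_cone_atoms)
    show "m - 2 + 2 \<le> card (V.cone_atoms A)" using V_card S(3) by simp
    show "finite BE" using finb by (simp add: BE_def)
    fix S' x y
    assume "S' \<subseteq> V.cone_atoms A" "card S' \<le> m - 2" "x \<in> V.cone_atoms A - S'" "y \<in> V.cone_atoms A - S'"
    then have "(V.edge_in (V.cone_atoms A - S'))\<^sup>*\<^sup>* x y" using V_conn S(3) by simp
    then show "(\<lambda>x y. x \<in> V.cone_atoms A - S' \<and> y \<in> V.cone_atoms A - S' \<and> V.edge x y)\<^sup>*\<^sup>* x y"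
      by (simp add: V.edge_in_def[abs_def])
  qed
  \<comment> \<open>Invariant along the path around \<open>v\<close>: every vertex other than
    \<open>v\<close> of the face \<open>scirc v w\<close> is reachable. An edge of that path
    corresponds to a face \<open>T\<close> of \<open>L\<close> containing \<open>v\<close>, in which
    \<open>v\<close> can be avoided.\<close>
  have "\<forall>z\<in>atoms. sle z (scirc v w) \<longrightarrow> z \<noteq> v \<longrightarrow> (edge_in ?W)\<^sup>*\<^sup>* a z"
    if "?R\<^sup>*\<^sup>* (away v a) w" for w
    using that
  proof (induction rule: rtranclp_induct)
    case base
    then show ?case using neighbour[OF a] by auto
  next
    case (step c d)
    have cd: "c \<in> V.atoms" "in_cone A c" "c \<notin> block" "d \<in> V.atoms" "in_cone A d" "d \<notin> block"
        "V.edge c d" "{c, d} \<notin> BE"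
      using step.hyps(2) by (auto simp: V.cone_atoms_def BV_def)
    obtain Z where Z: "Z \<in> away v ` L" "{w \<in> V.atoms. sle w Z} = {c, d}"
      using cd(7) by (auto simp: V.edge_def)
    have leZ: "sle c Z" "sle d Z" using Z(2) by blast+
    obtain Z' where Z': "Z' \<in> L" "Z = away v Z'" using Z(1) by blast
    \<comment> \<open>Every nonzero sign of \<open>Z\<close> is a sign of one of its vertices, and
      these are \<open>c\<close> and \<open>d\<close>.\<close>
    have "in_cone A Z"
      unfolding in_cone_def
    proof
      fix e
      show "Z e = Zero \<or> Z e \<in> A e"
      proof (cases "Z e = Zero")
        case False
        then obtain w where w: "w \<in> V.atoms" "sle w Z" "w e \<noteq> Zero" using V.atom_below[OF Z(1)] by blast
        then have "w = c \<or> w = d" using Z(2) by blast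
        then have "w e \<in> A e" using cd(2,5) w(3) unfolding in_cone_def by blast
        moreover have "w e = Z e" using w(2,3) unfolding sle_def by metis
        ultimately show ?thesis by simp
      qed simp
    qed
    define T where "T = scirc v Z"
    have T: "T \<in> L" "sle v T" "in_cone A T"
      using L_circ[OF va(2) Z'(1)] Z'(2) in_cone_scirc[OF va(3) \<open>in_cone A Z\<close>] by (auto simp: T_def)
    have lift_le: "sle (scirc v c) T" "sle (scirc v d) T" using leZ sle_lift by (auto simp: T_def)
    \<comment> \<open>A deleted vertex in \<open>T\<close> would be seen around \<open>v\<close> as
      a face of the edge from \<open>c\<close> to \<open>d\<close>: as one of its ends, or as the
      edge itself. Both are blocked, and the path avoids blocked vertices and edges.\<close>
    have Tsub: "{w \<in> atoms. sle w T \<and> w \<noteq> v} \<subseteq> ?W"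
    proof
      fix z assume "z \<in> {w \<in> atoms. sle w T \<and> w \<noteq> v}"
      then have z: "z \<in> atoms" "sle z T" "z \<noteq> v" by auto
      have conf: "ssep z v = {}" using ssep_conformal z(2) T(2) by blast
      have nz: "away v z \<noteq> szero" using away_nonzero[OF va(1) z(1,3) conf] .
      have le: "sle (away v z) Z" using sle_away z(2) by (simp add: T_def)
      have zV: "away v z \<in> away v ` L" using z(1) atomsD by blast
      have below: "u \<in> {c, d}" if "u \<in> V.atoms" "sle u (away v z)" for u
        using that Z(2) le sle_trans by blast
      have "z \<notin> S"
      proof
        assume "z \<in> S"
        then have bl: "away v z \<in> block" using conf by (auto simp: block_def)
        then have na: "away v z \<notin> V.atoms" using below[of "away v z"] cd(3,6)
          by (metis empty_iff insert_iff sle_refl)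
        \<comment> \<open>A face with a single vertex \<open>u\<close> has the support of
          \<open>u\<close> and so equals it; as \<open>away v z\<close> is not a vertex, it contains
          both \<open>c\<close> and \<open>d\<close>.\<close>
        have "{u \<in> V.atoms. sle u (away v z)} = {c, d}"
        proof (rule ccontr)
          assume "{u \<in> V.atoms. sle u (away v z)} \<noteq> {c, d}"
          then obtain u where u: "{w \<in> V.atoms. sle w (away v z)} \<subseteq> {u}" "u \<in> V.atoms"
            using below cd(1,4) by blast
          obtain u' where "u' \<in> V.atoms" "sle u' (away v z)" using V.atom_ex[OF zV nz] by blast
          then have ule: "sle u (away v z)" using u by blast
          have "ssupp (away v z) \<subseteq> ssupp u"
          proof
            fix e assume "e \<in> ssupp (away v z)"
            then obtain w where w: "w \<in> V.atoms" "sle w (away v z)" "w e \<noteq> Zero"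
              using V.atom_below[OF zV] by auto
            then have "w = u" using u(1) by blast
            then show "e \<in> ssupp u" using w(3) by simp
          qed
          then have "u = away v z" using sle_ssupp_eq[OF ule] by blast
          then show False using na u(2) by blast
        qed
        then have "{c, d} \<in> BE" using bl na unfolding BE_def by blast
        then show False using cd(8) by blast
      qed
      moreover have "in_cone A z" using in_cone_sle T(3) z(2) .
      ultimately show "z \<in> ?W" using z(1,3) by (simp add: cone_atoms_def)
    qed
    show ?case
    proof (intro ballI impI)
      fix z assume z: "z \<in> atoms" "sle z (scirc v d)" "z \<noteq> v"
      obtain C' where C': "C' \<in> L" "c = away v C'" using V.atomsD(1)[OF cd(1)] by blast
      obtain e where e: "c e \<noteq> Zero" using V.atomsD(2)[OF cd(1)] unfolding nonzero_ex by blast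
      then have ve: "v e = Zero" "scirc v c e \<noteq> Zero"
        using C'(2) by (auto simp: away_apply scirc_apply split: if_splits)
      moreover have "scirc v c \<in> L" using L_circ[OF va(2) C'(1)] C'(2) by simp
      ultimately obtain u where u: "u \<in> atoms" "sle u (scirc v c)" "u e \<noteq> Zero"
        using atom_below by blast
      have uv: "u \<noteq> v" using u(3) ve(1) by auto
      have "(edge_in {w \<in> atoms. sle w T \<and> w \<noteq> v})\<^sup>*\<^sup>* u z"
        using face_connected_avoiding[OF T(1) va(1) T(2)] u(1,2) z uv lift_le sle_trans by blast
      then have "(edge_in ?W)\<^sup>*\<^sup>* u z" using Tsub by (rule edge_in_mono)
      then show "(edge_in ?W)\<^sup>*\<^sup>* a z" using step.IH u(1,2) uv by (meson rtranclp_trans)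
    qed
  qed
  moreover have "sle b (scirc v (away v b))" using neighbour[OF b] by auto
  moreover have "b \<in> atoms" "b \<noteq> v" using b by (auto simp: cone_atoms_def edge_def)
  ultimately show ?thesis using path by blast
qed

end

text \<open>Outer induction on the rank bound, inner induction on the deleted set. When
  \<open>v\<close> is deleted after \<open>S\<close>, paths through \<open>v\<close> are rerouted
  around it, where the rank bound drops from \<open>Suc m\<close> to \<open>m\<close> and the number
  of deleted vertices drops by one as well.\<close>

theorem cone_connected:
  assumes "covector_system E L" "U \<in> L" "in_cone A U" "\<forall>W\<in>L. ssupp W \<subseteq> ssupp U" "rank_ge L m"
    and "S \<subseteq> covector_system.cone_atoms L A" "card S + 2 \<le> m"
    and "x \<in> covector_system.cone_atoms L A - S" "y \<in> covector_system.cone_atoms L A - S"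
  shows "(covector_system.edge_in L (covector_system.cone_atoms L A - S))\<^sup>*\<^sup>* x y"
  using assms
proof (induction m arbitrary: L U S x y)
  case (Suc m)
  interpret covector_system E L by fact
  have "finite S" using Suc.prems(6) finite_cone_atoms finite_subset by blast
  then show ?case using Suc.prems(6-9)
  proof (induction S arbitrary: x y rule: finite_induct)
    case empty
    have "2 \<le> Suc m" using empty.prems(2) by simp
    then obtain j where j: "Suc m = 2 + j" using le_Suc_ex by blast
    have "rank_ge L 2" if "rank_ge L (2 + j)" for j L
      using that
    proof (induction j)
      case (Suc j)
      obtain e where "rank_ge {W \<in> L. W e = Zero} (2 + j)" using Suc.prems by auto
      then have "rank_ge L (2 + j)" by (rule rank_ge_mono) blast
      then show ?case by (rule Suc.IH)
    qed simp
    then have "rank_ge L 2" using Suc.prems(5) j by simp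
    then show ?case using cone_connected_rank2[OF Suc.prems(2-4)] empty.prems by simp
  next
    case (insert v S)
    let ?W = "cone_atoms A - insert v S"
    have v: "v \<in> cone_atoms A" "S \<subseteq> cone_atoms A" using insert.prems by auto
    have va: "v \<in> atoms" "v \<in> L" using v atomsD by (auto simp: cone_atoms_def)
    have card: "card S + 2 \<le> m" using insert.prems(2) insert.hyps by simp
    interpret V: covector_system E "away v ` L" by (rule away_system)
    have U': "away v U \<in> away v ` L" "in_cone A (away v U)"
        "\<forall>W\<in>away v ` L. ssupp W \<subseteq> ssupp (away v U)"
      using Suc.prems(2-4) in_cone_away by (auto simp: away_apply subset_iff)
    have r: "rank_ge (away v ` L) m" using rank_ge_away[OF Suc.prems(1,5) va(1)] .
    have "m \<le> card {w \<in> V.atoms. sle w (away v U)}" using card_atoms_below[OF away_system U'(1,3) r] .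
    also have "\<dots> \<le> card (V.cone_atoms A)"
      using V.finite_cone_atoms U'(2) in_cone_sle by (intro card_mono) (auto simp: V.cone_atoms_def)
    finally have Vcard: "m \<le> card (V.cone_atoms A)" .
    have reroute: "(edge_in ?W)\<^sup>*\<^sup>* a b"
      if "a \<in> cone_atoms A - S" "edge a v" "b \<in> cone_atoms A - S" "edge b v" for a b
      using bypass[OF v insert.hyps(2) card that Vcard] Suc.IH[OF away_system U' r] by blast
    have "(edge_in (cone_atoms A - S))\<^sup>*\<^sup>* x y" using insert.IH[of x y] v(2) card insert.prems by simp
    \<comment> \<open>While the path stands at \<open>v\<close>, the claim covers all neighbours of
      \<open>v\<close> outside \<open>S\<close>, so the next step of the path can be taken whichever
      neighbour it leads to.\<close>
    then have "(y \<noteq> v \<longrightarrow> (edge_in ?W)\<^sup>*\<^sup>* x y) \<and>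
      (y = v \<longrightarrow> (\<forall>b\<in>cone_atoms A - S. edge b v \<longrightarrow> (edge_in ?W)\<^sup>*\<^sup>* x b))"
    proof (induction rule: rtranclp_induct)
      case base
      then show ?case using insert.prems(3) by auto
    next
      case (step w w2)
      have w: "w \<in> cone_atoms A - S" "w2 \<in> cone_atoms A - S" "edge w w2" "w \<noteq> w2"
        using step.hyps(2) by (auto simp: edge_in_def edge_def)
      consider "w = v" | "w2 = v" | "w \<noteq> v" "w2 \<noteq> v" by blast
      then show ?case
      proof cases
        case 1
        then show ?thesis using step.IH w edge_sym by auto
      next
        case 2
        then show ?thesis using step.IH w reroute by (meson rtranclp_trans)
      next
        case 3
        then have "edge_in ?W w w2" using w by (simp add: edge_in_def)
        then show ?thesis using step.IH 3 by auto
      qed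
    qed
    then show ?case using insert.prems(4) by blast
  qed
qed simp

section \<open>Cocircuit graphs\<close>

text \<open>The last step of the chain makes some \<open>e\<close> nonzero at which
  \<open>f m\<close> vanished; contracting \<open>e\<close> keeps all covectors supported inside
  \<open>f m\<close>.\<close>

lemma strict_chain_rank_ge:
  fixes f :: "nat \<Rightarrow> 'a \<Rightarrow> sign"
  assumes "\<forall>i\<le>m. f i \<in> L" "\<forall>i<m. sle (f i) (f (Suc i)) \<and> f i \<noteq> f (Suc i)"
  shows "rank_ge {W \<in> L. ssupp W \<subseteq> ssupp (f m)} m"
  using assms
proof (induction m)
  case (Suc m)
  have lt: "sle (f m) (f (Suc m))" "f m \<noteq> f (Suc m)" using Suc.prems(2) by auto
  then obtain e where e: "f (Suc m) e \<noteq> Zero" "f m e = Zero"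
    using sle_ssupp_psubset[OF lt] by auto
  let ?L = "{W \<in> L. ssupp W \<subseteq> ssupp (f (Suc m))}"
  have "rank_ge {W \<in> L. ssupp W \<subseteq> ssupp (f m)} m" using Suc by simp
  moreover have "{W \<in> L. ssupp W \<subseteq> ssupp (f m)} \<subseteq> {W \<in> ?L. W e = Zero}"
  proof
    fix W assume W: "W \<in> {W \<in> L. ssupp W \<subseteq> ssupp (f m)}"
    then have "W e = Zero" using e(2) by (auto simp: subset_iff)
    then show "W \<in> {W \<in> ?L. W e = Zero}" using W sle_ssupp[OF lt(1)] by blast
  qed
  ultimately have "rank_ge {W \<in> ?L. W e = Zero} m" by (rule rank_ge_mono)
  moreover have "f (Suc m) \<in> ?L" using Suc.prems(1) by simp
  ultimately show ?case using e(1) unfolding rank_ge.simps by blast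
qed simp

section \<open>Translation between signed sets and sign functions\<close>

lemma sign_at_eq_iff:
  assumes "pos X \<inter> neg X = {}" "pos Y \<inter> neg Y = {}"
  shows "sign_at X = sign_at Y \<longleftrightarrow> X = Y"
proof
  assume eq: "sign_at X = sign_at Y"
  have p: "pos Z = {e. sign_at Z e = Plus}" for Z :: "'a signed_set" by (auto simp: sign_at_def)
  have n: "neg Z = {e. sign_at Z e = Minus}" if "pos Z \<inter> neg Z = {}" for Z :: "'a signed_set"
    using that by (auto simp: sign_at_def)
  have "pos X = pos Y" using eq p by metis
  moreover have "neg X = neg Y" using eq n[OF assms(1)] n[OF assms(2)] by simp
  ultimately show "X = Y" by (simp add: prod_eq_iff)
qed simp

lemma sign_at_opp: "pos X \<inter> neg X = {} \<Longrightarrow> sign_at (opp X) = sneg (sign_at X)"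
  by (rule ext) (auto simp: sign_at_def opp_def)

lemma sign_at_empty: "sign_at empty_ss = szero"
  by (rule ext) (auto simp: sign_at_def empty_ss_def)

lemma sign_at_comp: "pos X \<inter> neg X = {} \<Longrightarrow> pos Y \<inter> neg Y = {} \<Longrightarrow>
    sign_at (comp_ss X Y) = scirc (sign_at X) (sign_at Y)"
  by (rule ext) (auto simp: sign_at_def comp_ss_def scirc_apply)

lemma ssupp_sign_at: "ssupp (sign_at X) = supp X"
  by (auto simp: sign_at_def supp_def split: if_splits)

lemma separator_eq_ssep:
  assumes "pos X \<inter> neg X = {}" "pos Y \<inter> neg Y = {}"
  shows "separator X Y = ssep (sign_at X) (sign_at Y)"
proof -
  have p: "e \<in> pos Z \<longleftrightarrow> sign_at Z e = Plus" for Z and e :: 'a by (simp add: sign_at_def)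
  have n: "e \<in> neg Z \<longleftrightarrow> sign_at Z e = Minus" if "pos Z \<inter> neg Z = {}" for Z and e :: 'a
    using that by (auto simp: sign_at_def)
  have "e \<in> separator X Y \<longleftrightarrow> e \<in> ssep (sign_at X) (sign_at Y)" for e
    unfolding separator_def mem_ssep Un_iff Int_iff p n[OF assms(1)] n[OF assms(2)]
    by (cases "sign_at X e") auto
  then show ?thesis by blast
qed

lemma le_ss_iff:
  assumes "pos X \<inter> neg X = {}" "pos Y \<inter> neg Y = {}"
  shows "le_ss Y X \<longleftrightarrow> sle (sign_at Y) (sign_at X)"
  by (simp add: le_ss_def sle_iff_ssep separator_eq_ssep[OF assms] ssupp_sign_at)

section \<open>Connectedness and crabbed paths as reachability\<close>

lemma cocircuit_graph_simps:
  "verts (cocircuit_graph C) = C" "arcs (cocircuit_graph C) = {(X, Y). cocircuit_adj C X Y}"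
  "tail (cocircuit_graph C) = fst" "head (cocircuit_graph C) = snd"
  by (simp_all add: cocircuit_graph_def)

text \<open>Connectedness in the graph library includes having a vertex, hence the condition that
  \<open>W\<close> is nonempty.\<close>

lemma connected_induce_cocircuit_graph:
  assumes "W \<subseteq> C" "W \<noteq> {}"
  shows "Digraph_Component.connected (cocircuit_graph C \<restriction> W) \<longleftrightarrow>
    (\<forall>x\<in>W. \<forall>y\<in>W. (\<lambda>a b. a \<in> W \<and> b \<in> W \<and> cocircuit_adj C a b)\<^sup>*\<^sup>* x y)"
proof -
  let ?R = "\<lambda>a b. a \<in> W \<and> b \<in> W \<and> cocircuit_adj C a b"
  have ends: "arcs_ends (cocircuit_graph C \<restriction> W) = {(a, b). ?R a b}"
    by (auto simp: arcs_ends_conv induce_subgraph_def cocircuit_graph_def)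
  have sym: "(arcs_ends (cocircuit_graph C \<restriction> W))\<^sup>s = {(a, b). ?R a b}"
    unfolding ends by (auto simp: symcl_def) (erule cocircuit_adj_sym)
  have "(x, y) \<in> rtrancl_on W {(a, b). ?R a b} \<longleftrightarrow> ?R\<^sup>*\<^sup>* x y" if "x \<in> W" for x y
  proof
    assume "(x, y) \<in> rtrancl_on W {(a, b). ?R a b}"
    then show "?R\<^sup>*\<^sup>* x y"
      by (induction rule: rtrancl_on_induct) (auto intro: rtranclp.rtrancl_into_rtrancl)
  next
    assume "?R\<^sup>*\<^sup>* x y"
    then show "(x, y) \<in> rtrancl_on W {(a, b). ?R a b}"
      by (induction rule: rtranclp_induct) (use that in \<open>auto intro: rtrancl_on_into_rtrancl_on\<close>)
  qed
  then show ?thesis unfolding connected_conv sym using assms by simp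
qed

definition hull_verts :: "'a signed_set set \<Rightarrow> 'a signed_set list \<Rightarrow> 'a signed_set set" where
  "hull_verts C Xs = {Z \<in> C. \<forall>e. sign_at Z e \<in> insert Zero ((\<lambda>X. sign_at X e) ` set Xs)}"

lemma verts_crabbed_hull: "verts (crabbed_hull C Xs) = hull_verts C Xs"
  by (simp add: crabbed_hull_def hull_verts_def)

lemma arcs_crabbed_hull: "arcs (crabbed_hull C Xs) =
    {(a, b). a \<in> hull_verts C Xs \<and> b \<in> hull_verts C Xs \<and> cocircuit_adj C a b}"
  by (auto simp: crabbed_hull_def hull_verts_def induce_subgraph_def cocircuit_graph_def)

lemma induce_crabbed_hull:
  "W \<subseteq> hull_verts C Xs \<Longrightarrow> crabbed_hull C Xs \<restriction> W = cocircuit_graph C \<restriction> W"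
  unfolding crabbed_hull_def hull_verts_def[symmetric] by (auto simp: induce_subgraph_def)

text \<open>A walk in the hull can be shortened to a path without repeated vertices there, and a
  path of an induced subgraph is a path of the whole graph.\<close>

lemma crabbed_path_iff:
  assumes "finite C" "X \<in> C" "Y \<in> C"
  shows "(\<exists>p. crabbed_path C X p Y) \<longleftrightarrow>
    (\<lambda>a b. a \<in> hull_verts C [X, Y] \<and> b \<in> hull_verts C [X, Y] \<and> cocircuit_adj C a b)\<^sup>*\<^sup>* X Y"
    (is "_ \<longleftrightarrow> ?R\<^sup>*\<^sup>* X Y")
proof
  interpret G: graph "cocircuit_graph C" by (rule graph_cocircuit_graph[OF assms(1)])
  assume "\<exists>p. crabbed_path C X p Y"
  then obtain p where "G.cas X p Y" "set p \<subseteq> arcs (crabbed_hull C [X, Y])"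
    by (auto simp: crabbed_path_def G.apath_def G.awalk_def)
  moreover have "(\<lambda>a b. a \<in> W \<and> b \<in> W \<and> cocircuit_adj C a b)\<^sup>*\<^sup>* X Y"
    if "G.cas X p Y" "set p \<subseteq> {(a, b). a \<in> W \<and> b \<in> W \<and> cocircuit_adj C a b}" for W X
    using that
  proof (induction p arbitrary: X)
    case Nil
    then show ?case by (simp add: G.cas.simps)
  next
    case (Cons a p)
    obtain b c where a: "a = (b, c)" by (cases a)
    have *: "b = X" "G.cas c p Y"
      using Cons.prems(1) unfolding a G.cas.simps cocircuit_graph_simps by simp_all
    have "(\<lambda>a b. a \<in> W \<and> b \<in> W \<and> cocircuit_adj C a b)\<^sup>*\<^sup>* c Y"
      using Cons.IH[OF *(2)] Cons.prems(2) by simp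
    moreover have "X \<in> W \<and> c \<in> W \<and> cocircuit_adj C X c" using Cons.prems(2) a *(1) by simp
    ultimately show ?case by (rule converse_rtranclp_into_rtranclp[rotated])
  qed
  ultimately show "?R\<^sup>*\<^sup>* X Y" unfolding arcs_crabbed_hull by blast
next
  interpret G: graph "cocircuit_graph C" by (rule graph_cocircuit_graph[OF assms(1)])
  let ?H = "crabbed_hull C [X, Y]"
  have sub: "hull_verts C [X, Y] \<subseteq> verts (cocircuit_graph C)"
    by (auto simp: hull_verts_def cocircuit_graph_simps)
  have ind: "induced_subgraph ?H (cocircuit_graph C)"
    unfolding crabbed_hull_def using sub[unfolded hull_verts_def] by (rule G.induced_induce)
  then have subg: "subgraph ?H (cocircuit_graph C)" by (rule induced_imp_subgraph)
  interpret H: wf_digraph ?H using subg by (auto simp: subgraph_def)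
  assume R: "?R\<^sup>*\<^sup>* X Y"
  have XH: "X \<in> verts ?H" unfolding verts_crabbed_hull hull_verts_def using assms(2) by simp
  have "arcs_ends ?H = {(a, b). ?R a b}"
    by (auto simp: arcs_ends_conv induce_subgraph_def cocircuit_graph_def crabbed_hull_def hull_verts_def)
  then have eq: "?R = (\<lambda>a b. (a, b) \<in> arcs_ends ?H)" by (simp add: fun_eq_iff)
  have "(X, Y) \<in> (arcs_ends ?H)\<^sup>*" using R unfolding eq rtranclp_rtrancl_eq by simp
  then have "X \<rightarrow>\<^sup>*\<^bsub>?H\<^esub> Y" using H.reachable_conv'[OF XH] by simp
  then obtain p where p: "H.apath X p Y" using H.reachable_apath by blast
  have "G.awalk_verts = H.awalk_verts"
    by (rule compatible_awalk_verts) (use subg in \<open>simp add: subgraph_def\<close>)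
  moreover have "set (H.awalk_verts X p) \<subseteq> verts ?H" using p H.awalk_verts_in_verts
    by (auto simp: H.apath_def)
  moreover have "set p \<subseteq> arcs ?H" using p by (auto simp: H.apath_def H.awalk_def)
  ultimately have "crabbed_path C X p Y"
    unfolding crabbed_path_def using G.subgraph_apath_imp_apath[OF p subg] by simp
  then show "\<exists>p. crabbed_path C X p Y" by blast
qed

lemma comp_list_simps: "comp_list [] = empty_ss" "comp_list (X # Xs) = comp_ss X (comp_list Xs)"
  by (simp_all add: comp_list_def)

lemma covectors_top_cases: "Elem U \<in> covectors_top C \<longleftrightarrow> U \<in> covectors C"
  by (auto simp: covectors_top_def)

definition top_chain :: "'a signed_set set \<Rightarrow> 'a signed_set \<Rightarrow> nat \<Rightarrow> (nat \<Rightarrow> 'a signed_set with_top) \<Rightarrow> bool" where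
  "top_chain C U m c \<longleftrightarrow> c 0 = Elem empty_ss \<and> c m = Elem U \<and>
     (\<forall>i\<le>m. c i \<in> covectors_top C) \<and> (\<forall>i<m. lt_top (c i) (c (Suc i)))"

lemma height_eq_Max: "height C U = Max {m. \<exists>c. top_chain C U m c}"
  by (simp add: height_def top_chain_def)

section \<open>Heights, and elimination from crabbed paths\<close>

locale signed_system =
  fixes E :: "'a set" and C :: "'a signed_set set"
  assumes finite_E: "finite E"
    and signed: "X \<in> C \<Longrightarrow> signed_set_on E X"
    and no_empty: "empty_ss \<notin> C"
    and symmetric: "C = opp ` C"
    and incomparable: "X \<in> C \<Longrightarrow> Y \<in> C \<Longrightarrow> supp X \<subseteq> supp Y \<Longrightarrow> X = Y \<or> X = opp Y"
begin

lemma finite_C: "finite C"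
proof (rule finite_subset)
  show "C \<subseteq> Pow E \<times> Pow E"
  proof
    fix X assume "X \<in> C"
    then have "signed_set_on E X" by (rule signed)
    then show "X \<in> Pow E \<times> Pow E" by (cases X) (simp add: signed_set_on_def)
  qed
  show "finite (Pow E \<times> Pow E)" using finite_E by simp
qed

lemma disj: "X \<in> C \<Longrightarrow> pos X \<inter> neg X = {}"
  using signed by (auto simp: signed_set_on_def)

lemma comp_list_signed: "set Xs \<subseteq> C \<Longrightarrow> signed_set_on E (comp_list Xs)"
proof (induction Xs)
  case Nil
  then show ?case by (simp add: comp_list_simps empty_ss_def signed_set_on_def)
next
  case (Cons X Xs)
  then have "signed_set_on E X" "signed_set_on E (comp_list Xs)" using signed by auto
  then show ?case unfolding comp_list_simps comp_ss_def signed_set_on_def by auto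
qed

lemma covector_signed: "U \<in> covectors C \<Longrightarrow> signed_set_on E U"
  using comp_list_signed by (auto simp: covectors_def)

lemma covector_disj: "U \<in> covectors C \<Longrightarrow> pos U \<inter> neg U = {}"
  using covector_signed by (auto simp: signed_set_on_def)

lemma empty_covector: "empty_ss \<in> covectors C"
  unfolding covectors_def using comp_list_simps(1) by (metis (mono_tags, lifting) empty_set empty_subsetI mem_Collect_eq)

lemma C_covector: "X \<in> C \<Longrightarrow> X \<in> covectors C"
proof -
  assume "X \<in> C"
  moreover have "comp_list [X] = X" by (simp add: comp_list_simps comp_ss_def empty_ss_def)
  ultimately show "X \<in> covectors C"
    unfolding covectors_def by (metis (mono_tags, lifting) empty_set insert_subset list.simps(15) empty_subsetI mem_Collect_eq)
qed

lemma sign_at_comp_list_Cons: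
  "set (X # Xs) \<subseteq> C \<Longrightarrow> sign_at (comp_list (X # Xs)) = scirc (sign_at X) (sign_at (comp_list Xs))"
  unfolding comp_list_simps
  by (rule sign_at_comp) (use disj comp_list_signed[of Xs] in \<open>auto simp: signed_set_on_def\<close>)

lemma sign_at_comp_list_append:
  "set Xs \<subseteq> C \<Longrightarrow> set Ys \<subseteq> C \<Longrightarrow>
    sign_at (comp_list (Xs @ Ys)) = scirc (sign_at (comp_list Xs)) (sign_at (comp_list Ys))"
proof (induction Xs)
  case Nil
  then show ?case by (simp add: comp_list_simps sign_at_empty) (simp add: scirc_def)
next
  case (Cons X Xs)
  have "sign_at (comp_list ((X # Xs) @ Ys)) = scirc (sign_at X) (sign_at (comp_list (Xs @ Ys)))"
    using sign_at_comp_list_Cons[of X "Xs @ Ys"] Cons.prems by simp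
  also have "\<dots> = scirc (sign_at X) (scirc (sign_at (comp_list Xs)) (sign_at (comp_list Ys)))"
    using Cons by simp
  also have "\<dots> = scirc (scirc (sign_at X) (sign_at (comp_list Xs))) (sign_at (comp_list Ys))"
    by (auto simp: scirc_def)
  finally show ?case using sign_at_comp_list_Cons[OF Cons.prems(1)] by simp
qed

lemma top_chain_elems:
  assumes "top_chain C U m c"
  obtains d where "\<forall>i\<le>m. c i = Elem (d i) \<and> d i \<in> covectors C"
    "\<forall>i<m. sle (sign_at (d i)) (sign_at (d (Suc i))) \<and> sign_at (d i) \<noteq> sign_at (d (Suc i))"
    "d 0 = empty_ss" "d m = U"
proof -
  have c: "c 0 = Elem empty_ss" "c m = Elem U" "\<forall>i\<le>m. c i \<in> covectors_top C"
      "\<forall>i<m. lt_top (c i) (c (Suc i))"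
    using assms by (auto simp: top_chain_def)
  \<comment> \<open>Nothing but \<open>Top\<close> lies above \<open>Top\<close>, so a chain ending
    in \<open>Elem U\<close> never visits it; the argument runs down from the end of the
    chain.\<close>
  have nt: "c i \<noteq> Top" if "i \<le> m" for i
    using that
  proof (induction rule: inc_induct)
    case base
    then show ?case using c(2) by simp
  next
    case (step i)
    then have "le_top (c i) (c (Suc i))" using c(4) by (auto simp: lt_top_def)
    then show ?case using step.IH by (cases "c (Suc i)") auto
  qed
  define d where "d i = (case c i of Elem x \<Rightarrow> x | Top \<Rightarrow> empty_ss)" for i
  have d: "c i = Elem (d i) \<and> d i \<in> covectors C" if "i \<le> m" for i
  proof -
    have "c i = Elem (d i)" using nt[OF that] by (cases "c i") (auto simp: d_def)
    moreover have "c i \<in> covectors_top C" using c(3) that by blast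
    ultimately show ?thesis using covectors_top_cases by metis
  qed
  have "sle (sign_at (d i)) (sign_at (d (Suc i))) \<and> sign_at (d i) \<noteq> sign_at (d (Suc i))" if "i < m" for i
  proof -
    have di: "c i = Elem (d i)" "d i \<in> covectors C" "c (Suc i) = Elem (d (Suc i))" "d (Suc i) \<in> covectors C"
      using d[of i] d[of "Suc i"] that by auto
    have "lt_top (c i) (c (Suc i))" using c(4) that by blast
    then have "le_ss (d i) (d (Suc i))" "d i \<noteq> d (Suc i)" using di by (auto simp: lt_top_def)
    then show ?thesis
      using le_ss_iff sign_at_eq_iff covector_disj di(2,4) by metis
  qed
  moreover have "d 0 = empty_ss" "d m = U" using c(1,2) by (simp_all add: d_def)
  ultimately show thesis using that d by blast
qed

text \<open>Supports grow strictly along a chain. The bound makes the set of chain lengths finite,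
  so its maximum is meaningful.\<close>

lemma top_chain_length:
  assumes "top_chain C U m c"
  shows "m \<le> card E"
proof -
  obtain d where d: "\<forall>i\<le>m. c i = Elem (d i) \<and> d i \<in> covectors C"
    "\<forall>i<m. sle (sign_at (d i)) (sign_at (d (Suc i))) \<and> sign_at (d i) \<noteq> sign_at (d (Suc i))"
    using top_chain_elems[OF assms] by metis
  have sub: "supp (d i) \<subseteq> E" if "i \<le> m" for i
    using d(1) that covector_signed by (auto simp: signed_set_on_def supp_def)
  have "i \<le> card (supp (d i))" if "i \<le> m" for i
    using that
  proof (induction i)
    case (Suc i)
    have "supp (d i) \<subset> supp (d (Suc i))"
      using d(2) Suc.prems sle_ssupp_psubset ssupp_sign_at by (metis Suc_le_lessD)
    then have "card (supp (d i)) < card (supp (d (Suc i)))"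
      using sub[OF Suc.prems] finite_E by (meson finite_subset psubset_card_mono)
    then show ?case using Suc by simp
  qed simp
  then have "m \<le> card (supp (d m))" by simp
  also have "\<dots> \<le> card E" using sub finite_E by (simp add: card_mono)
  finally show ?thesis .
qed

lemma finite_chain_lengths: "finite {m. \<exists>c. top_chain C U m c}"
proof (rule finite_subset)
  show "{m. \<exists>c. top_chain C U m c} \<subseteq> {..card E}" using top_chain_length by blast
qed simp

lemma height_ge: "top_chain C U m c \<Longrightarrow> m \<le> height C U"
  unfolding height_eq_Max using finite_chain_lengths by (intro Max_ge) auto

lemma height_chain:
  assumes "U \<in> covectors C"
  shows "\<exists>c. top_chain C U (height C U) c"
proof -
  have "\<exists>m c. top_chain C U m c"
  proof (cases "U = empty_ss")
    case True
    then have "top_chain C U 0 (\<lambda>_. Elem empty_ss)"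
      using empty_covector by (simp add: top_chain_def covectors_top_cases)
    then show ?thesis by blast
  next
    case False
    have "le_ss empty_ss U" by (simp add: le_ss_def separator_def supp_def empty_ss_def)
    then have "top_chain C U 1 (\<lambda>i. if i = 0 then Elem empty_ss else Elem U)"
      using empty_covector assms False by (auto simp: top_chain_def covectors_top_cases lt_top_def)
    then show ?thesis by blast
  qed
  then have "height C U \<in> {m. \<exists>c. top_chain C U m c}"
    unfolding height_eq_Max using finite_chain_lengths by (intro Max_in) auto
  then show ?thesis by simp
qed

text \<open>The added maximum makes the two elements adjacent when \<open>C\<close> consists of a
  single opposite pair, and these are not conformal. The cocircuits \<open>A\<close> and
  \<open>B\<close> rule this out: \<open>C\<close> then contains the three different elements
  \<open>A\<close>, \<open>B\<close> and \<open>opp B\<close>.\<close>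

lemma adj_conformal:
  assumes adj: "cocircuit_adj C X Y" and nontrivial: "A \<in> C" "B \<in> C" "A \<noteq> B" "A \<noteq> opp B"
  shows "ssep (sign_at X) (sign_at Y) = {}"
proof -
  obtain Z where Z: "Z \<in> covectors_top C" "{W \<in> C. le_top (Elem W) Z} = {X, Y}"
    and XY: "X \<in> C" "Y \<in> C" "X \<noteq> Y" using adj by (auto simp: cocircuit_adj_def)
  show ?thesis
  proof (cases Z)
    case Top
    then have "C = {X, Y}" using Z(2) by simp
    then have "C = {A, B}" using nontrivial by blast
    moreover have "opp B \<in> C" using symmetric nontrivial(2) by blast
    moreover have "opp B \<noteq> B"
    proof
      assume "opp B = B"
      then have "pos B = neg B" by (metis opp_def fst_conv)
      then have "pos B = {}" "neg B = {}" using disj[OF nontrivial(2)] by simp_all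
      then have "B = empty_ss" by (simp add: empty_ss_def prod_eq_iff)
      then show False using no_empty nontrivial(2) by simp
    qed
    ultimately show ?thesis using nontrivial(4) by blast
  next
    case (Elem U)
    then have U: "U \<in> covectors C" using Z(1) covectors_top_cases by metis
    have "le_ss X U" "le_ss Y U" using Z(2) Elem by auto
    then have "sle (sign_at X) (sign_at U)" "sle (sign_at Y) (sign_at U)"
      using le_ss_iff[OF covector_disj[OF U] disj[OF XY(1)]] le_ss_iff[OF covector_disj[OF U] disj[OF XY(2)]]
      by simp_all
    then show ?thesis by (rule ssep_conformal)
  qed
qed

lemma crabbed_paths_imp_oriented_matroid:
  assumes paths: "\<forall>X\<in>C. \<forall>Y\<in>C. X \<noteq> Y \<and> X \<noteq> opp Y \<longrightarrow> (\<exists>p. crabbed_path C X p Y)"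
  shows "oriented_matroid E C"
proof -
  have "\<exists>Z\<in>C. sign_at Z e = Zero \<and> pos Z \<subseteq> pos X \<union> pos Y \<and> neg Z \<subseteq> neg X \<union> neg Y"
    if X: "X \<in> C" and Y: "Y \<in> C" and ne: "X \<noteq> Y" "X \<noteq> opp Y" and e: "e \<in> separator X Y" for X Y e
  proof -
    let ?H = "hull_verts C [X, Y]"
    have path: "(\<lambda>a b. a \<in> ?H \<and> b \<in> ?H \<and> cocircuit_adj C a b)\<^sup>*\<^sup>* X Y"
      using crabbed_path_iff[OF finite_C X Y] paths X Y ne by blast
    have sep: "sign_at X e \<noteq> Zero" "sign_at Y e = flip (sign_at X e)"
      using e separator_eq_ssep[OF disj[OF X] disj[OF Y]] by (auto simp: mem_ssep)
    have XH: "X \<in> ?H" using X by (auto simp: hull_verts_def)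
    have "\<exists>Z\<in>?H. sign_at Z e = Zero"
    proof (rule ccontr)
      assume *: "\<not> ?thesis"
      have "sign_at Y e = sign_at X e"
        using path
      proof (induction rule: rtranclp_induct)
        case (step W V)
        then have W: "W \<in> ?H" "V \<in> ?H" "cocircuit_adj C W V" by auto
        have V: "sign_at V e = sign_at X e \<or> sign_at V e = flip (sign_at X e)"
        proof -
          have "sign_at V e \<in> insert Zero {sign_at X e, sign_at Y e}"
            using W(2) by (simp add: hull_verts_def)
          then show ?thesis using * W(2) sep(2) by auto
        qed
        have "e \<notin> ssep (sign_at W) (sign_at V)" using adj_conformal[OF W(3) X Y ne] by blast
        then show ?case using V step.IH sep(1) by (auto simp: mem_ssep)
      qed simp
      then show False using sep by auto
    qed
    then obtain Z where Z: "Z \<in> ?H" "sign_at Z e = Zero" by blast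
    have ZC: "Z \<in> C" and signs: "sign_at Z h \<in> {Zero, sign_at X h, sign_at Y h}" for h
      using Z(1) by (simp_all add: hull_verts_def)
    have "pos Z \<subseteq> pos X \<union> pos Y"
    proof
      fix h assume "h \<in> pos Z"
      then show "h \<in> pos X \<union> pos Y" using signs[of h] by (auto simp: sign_at_def split: if_splits)
    qed
    moreover have "neg Z \<subseteq> neg X \<union> neg Y"
    proof
      fix h assume "h \<in> neg Z"
      then show "h \<in> neg X \<union> neg Y"
        using signs[of h] disj[OF ZC] by (auto simp: sign_at_def split: if_splits)
    qed
    ultimately show ?thesis using ZC Z(2) by blast
  qed
  then show ?thesis
    unfolding oriented_matroid_def
    using finite_E signed no_empty symmetric incomparable by blast
qed

end

section \<open>From oriented matroids to connectivity, and from there to crabbed paths\<close>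

lemma (in weak_cocircuits) covector_system_compositions: "covector_system E compositions"
  by unfold_locales
    (use fin compositions_ssupp compositions.zero compositions_sneg compositions_scirc
      compositions_elim in blast)+

text \<open>By conformal decomposition each nonzero composition has a cocircuit below it;
  incomparability makes cocircuits minimal, since a conformal cocircuit cannot be the opposite
  one.\<close>

lemma (in weak_cocircuits) atoms_compositions: "covector_system.atoms compositions = C"
proof -
  interpret L: covector_system E compositions by (rule covector_system_compositions)
  have "X \<in> L.atoms" if X: "X \<in> C" for X
  proof -
    have "X \<noteq> szero" using X nonzero by blast
    moreover have "Y = X" if Y: "Y \<in> compositions" "Y \<noteq> szero" "sle Y X" for Y
    proof -
      obtain e where "Y e \<noteq> Zero" using Y(2) unfolding nonzero_ex by blast
      then obtain Z where Z: "Z \<in> C" "sle Z Y" "Z e \<noteq> Zero" using conformal_below Y(1) by blast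
      have ZX: "sle Z X" using Z(2) Y(3) by (rule sle_trans)
      have "Z \<noteq> sneg X"
      proof
        assume "Z = sneg X"
        then have "Z e = flip (X e)" by simp
        moreover have "Z e = X e" using ZX Z(3) unfolding sle_def by metis
        ultimately show False using Z(3) by simp
      qed
      then have "Z = X" using incomp[OF Z(1) X] sle_ssupp[OF ZX] by blast
      then show ?thesis using Z(2) Y(3) sle_antisym by blast
    qed
    ultimately show ?thesis using C_subset_compositions[OF X] unfolding L.atoms_def by blast
  qed
  moreover have "X \<in> C" if X: "X \<in> L.atoms" for X
  proof -
    obtain e where "X e \<noteq> Zero" using L.atomsD(2)[OF X] unfolding nonzero_ex by blast
    then obtain Z where Z: "Z \<in> C" "sle Z X" using conformal_below L.atomsD(1)[OF X] by blast
    have "Z \<noteq> szero" using Z(1) nonzero by blast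
    then have "Z = X" using L.atomsD(3)[OF X] Z C_subset_compositions by blast
    then show ?thesis using Z(1) by simp
  qed
  ultimately show ?thesis by blast
qed

lemma (in covector_system) atoms_subspace:
  "covector_system.atoms {W \<in> L. ssupp W \<subseteq> F} = {z \<in> atoms. ssupp z \<subseteq> F}"
proof -
  interpret S: covector_system E "{W \<in> L. ssupp W \<subseteq> F}" by (rule subspace_system)
  show ?thesis
    unfolding S.atoms_def atoms_def using sle_ssupp by blast
qed

context signed_system
begin

lemma weak_cocircuits_sign_at:
  assumes "oriented_matroid E C"
  shows "weak_cocircuits E (sign_at ` C)"
proof
  show "finite E" by (rule finite_E)
next
  fix X assume "X \<in> sign_at ` C"
  then obtain X' where X': "X' \<in> C" "X = sign_at X'" by blast
  have "supp X' \<subseteq> E" using signed[OF X'(1)] by (simp add: signed_set_on_def supp_def)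
  then show "ssupp X \<subseteq> E" using X'(2) by (simp add: ssupp_sign_at)
  have "opp X' \<in> C" using symmetric X'(1) by blast
  then show "sneg X \<in> sign_at ` C" using X'(2) sign_at_opp[OF disj[OF X'(1)]] by (metis imageI)
next
  show "szero \<notin> sign_at ` C"
  proof
    assume "szero \<in> sign_at ` C"
    then obtain X where X: "X \<in> C" "sign_at X = sign_at empty_ss" using sign_at_empty by (metis imageE)
    then have "X = empty_ss" using sign_at_eq_iff[OF disj[OF X(1)], of empty_ss] by (simp add: empty_ss_def)
    then show False using X(1) no_empty by simp
  qed
next
  fix X Y assume "X \<in> sign_at ` C" "Y \<in> sign_at ` C"
  then obtain X' Y' where XY: "X' \<in> C" "X = sign_at X'" "Y' \<in> C" "Y = sign_at Y'" by blast
  {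
    assume "ssupp X \<subseteq> ssupp Y"
    then have "X' = Y' \<or> X' = opp Y'" using incomparable[OF XY(1,3)] XY(2,4) by (simp add: ssupp_sign_at)
    then show "X = Y \<or> X = sneg Y" using XY(2,4) sign_at_opp[OF disj[OF XY(3)]] by auto
  }
  fix e assume ne: "X \<noteq> sneg Y" and e: "e \<in> ssep X Y"
  have "e \<in> separator X' Y'" using e separator_eq_ssep[OF disj[OF XY(1)] disj[OF XY(3)]] XY(2,4) by simp
  moreover have "X' \<noteq> opp Y'" using ne XY(2,4) sign_at_opp[OF disj[OF XY(3)]] by auto
  moreover have "X' \<noteq> Y'" using e XY(2,4) by (auto simp: mem_ssep)
  moreover have "\<forall>X\<in>C. \<forall>Y\<in>C. X \<noteq> Y \<and> X \<noteq> opp Y \<longrightarrow> (\<forall>e\<in>separator X Y. \<exists>Z\<in>C. sign_at Z e = Zero \<and>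
      pos Z \<subseteq> pos X \<union> pos Y \<and> neg Z \<subseteq> neg X \<union> neg Y)"
    using assms unfolding oriented_matroid_def by (elim conjE)
  ultimately obtain Z where Z: "Z \<in> C" "sign_at Z e = Zero" "pos Z \<subseteq> pos X' \<union> pos Y'"
      "neg Z \<subseteq> neg X' \<union> neg Y'"
    using XY(1,3) by meson
  have "sign_at Z h \<in> {Zero, X h, Y h}" for h
  proof (cases "sign_at Z h")
    case Plus
    then have "h \<in> pos X' \<union> pos Y'" using Z(3) by (auto simp: sign_at_def split: if_splits)
    then show ?thesis using Plus XY(2,4) by (auto simp: sign_at_def)
  next
    case Minus
    then have "h \<in> neg X' \<union> neg Y'" using Z(4) by (auto simp: sign_at_def split: if_splits)
    then show ?thesis using Minus XY(2,4) disj[OF XY(1)] disj[OF XY(3)] by (auto simp: sign_at_def)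
  qed simp
  then show "\<exists>Z\<in>sign_at ` C. Z e = Zero \<and> (\<forall>h. Z h \<in> {Zero, X h, Y h})"
    using Z(1,2) by blast
qed

text \<open>\<open>comp_list\<close> adds factors on the left and \<open>compositions\<close> on the
  right; associativity of composition reconciles the two.\<close>

lemma compositions_sign_at:
  assumes "oriented_matroid E C"
  shows "weak_cocircuits.compositions (sign_at ` C) = sign_at ` covectors C"
proof -
  interpret W: weak_cocircuits E "sign_at ` C" by (rule weak_cocircuits_sign_at[OF assms])
  have "sign_at (comp_list Xs) \<in> W.compositions" if "set Xs \<subseteq> C" for Xs
    using that
  proof (induction Xs)
    case Nil
    then show ?case using W.compositions.zero by (simp only: comp_list_simps sign_at_empty)
  next
    case (Cons X Xs)
    then have "sign_at X \<in> W.compositions" "sign_at (comp_list Xs) \<in> W.compositions"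
      using W.C_subset_compositions by auto
    then show ?case unfolding sign_at_comp_list_Cons[OF Cons.prems] by (rule W.compositions_scirc)
  qed
  moreover have "P \<in> sign_at ` covectors C" if "P \<in> W.compositions" for P
    using that
  proof (induction rule: W.compositions.induct)
    case zero
    then show ?case using empty_covector sign_at_empty by (metis imageI)
  next
    case (snoc P X)
    then obtain Xs X' where Xs: "set Xs \<subseteq> C" "P = sign_at (comp_list Xs)" "X' \<in> C" "X = sign_at X'"
      by (auto simp: covectors_def)
    have "comp_list [X'] = X'" by (simp add: comp_list_simps comp_ss_def empty_ss_def)
    then have "scirc P X = sign_at (comp_list (Xs @ [X']))"
      using sign_at_comp_list_append[of Xs "[X']"] Xs by simp
    moreover have "set (Xs @ [X']) \<subseteq> C" using Xs by simp
    ultimately show ?case unfolding covectors_def by blast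
  qed
  ultimately show ?thesis by (auto simp: covectors_def)
qed

lemma oriented_matroid_imp_m_connected:
  assumes om: "oriented_matroid E C" and Xs: "Xs \<noteq> []" "set Xs \<subseteq> C"
  shows "m_connected (height C (comp_list Xs) - 1) (crabbed_hull C Xs)"
proof -
  interpret W: weak_cocircuits E "sign_at ` C" by (rule weak_cocircuits_sign_at[OF om])
  interpret L: covector_system E W.compositions by (rule W.covector_system_compositions)
  define u where "u = comp_list Xs"
  define h where "h = height C u"
  \<comment> \<open>In all of \<open>W.compositions\<close> the composition \<open>u\<close> need
    not have full support, and the rank may exceed its height. Inside its own support
    \<open>u\<close> is full and its height is a lower bound for the rank.\<close>
  define L' where "L' = {P \<in> W.compositions. ssupp P \<subseteq> ssupp (sign_at u)}"
  define A where "A e = (\<lambda>X. sign_at X e) ` set Xs" for e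
  interpret S: covector_system E L' unfolding L'_def by (rule L.subspace_system)
  have Leq: "W.compositions = sign_at ` covectors C" by (rule compositions_sign_at[OF om])
  have uC: "u \<in> covectors C" using Xs(2) by (auto simp: u_def covectors_def)
  have S_atoms: "S.atoms = {z \<in> sign_at ` C. ssupp z \<subseteq> ssupp (sign_at u)}"
    unfolding L'_def L.atoms_subspace W.atoms_compositions ..
  \<comment> \<open>The second half says that \<open>u\<close> vanishes only where all generators
    do, so the support condition in \<open>L'\<close> removes no member of the hull.\<close>
  have u_sign: "sign_at (comp_list Ys) e \<in> insert Zero ((\<lambda>X. sign_at X e) ` set Ys) \<and>
      (sign_at (comp_list Ys) e = Zero \<longrightarrow> (\<forall>X\<in>set Ys. sign_at X e = Zero))"
    if "set Ys \<subseteq> C" for Ys e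
    using that
  proof (induction Ys)
    case Nil
    then show ?case by (simp add: comp_list_simps sign_at_empty)
  next
    case (Cons Y Ys)
    then show ?case unfolding sign_at_comp_list_Cons[OF Cons.prems] by (auto simp: scirc_apply)
  qed
  have cone_u: "in_cone A (sign_at u)"
    using u_sign[OF Xs(2)] by (auto simp: in_cone_def A_def u_def)
  have uL': "sign_at u \<in> L'" using uC by (auto simp: L'_def Leq)
  have full: "\<forall>P\<in>L'. ssupp P \<subseteq> ssupp (sign_at u)" by (simp add: L'_def)
  have cone: "S.cone_atoms A = sign_at ` hull_verts C Xs"
  proof -
    have "in_cone A z \<and> ssupp z \<subseteq> ssupp (sign_at u) \<longleftrightarrow>
        (\<forall>e. z e \<in> insert Zero ((\<lambda>X. sign_at X e) ` set Xs))" for z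
    proof -
      have "sign_at u e \<noteq> Zero" if "z e \<noteq> Zero" "z e \<in> A e" for e
        using that u_sign[OF Xs(2), of e] by (auto simp: A_def u_def)
      then show ?thesis by (auto simp: in_cone_def A_def)
    qed
    then show ?thesis unfolding S.cone_atoms_def S_atoms hull_verts_def by blast
  qed
  obtain c where c: "top_chain C u h c" using height_chain[OF uC] unfolding h_def by blast
  obtain d where d: "\<forall>i\<le>h. c i = Elem (d i) \<and> d i \<in> covectors C"
    "\<forall>i<h. sle (sign_at (d i)) (sign_at (d (Suc i))) \<and> sign_at (d i) \<noteq> sign_at (d (Suc i))"
    "d 0 = empty_ss" "d h = u" by (rule top_chain_elems[OF c])
  have rank: "rank_ge L' h"
    using strict_chain_rank_ge[of h "\<lambda>i. sign_at (d i)" W.compositions] d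
    unfolding L'_def by (simp add: Leq)
  have inj: "inj_on sign_at C"
    using sign_at_eq_iff disj by (metis inj_onI)
  have HC: "hull_verts C Xs \<subseteq> C" by (auto simp: hull_verts_def)
  have fin: "finite (hull_verts C Xs)" using HC finite_C finite_subset by blast
  have "card (hull_verts C Xs) = card (S.cone_atoms A)"
    unfolding cone using inj_on_subset[OF inj HC] by (simp add: card_image)
  moreover have "h \<le> card {w \<in> S.atoms. sle w (sign_at u)}"
    using card_atoms_below[OF S.covector_system_axioms uL' full rank] .
  moreover have "\<dots> \<le> card (S.cone_atoms A)"
    using S.finite_cone_atoms cone_u in_cone_sle by (intro card_mono) (auto simp: S.cone_atoms_def)
  ultimately have card: "h \<le> card (hull_verts C Xs)" by simp
  \<comment> \<open>More than h - 1 vertices are required, with truncated subtraction; besides the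
    bound by \<open>h\<close> this takes a nonempty hull.\<close>
  obtain X1 where "X1 \<in> set Xs" using Xs(1) by (cases Xs) auto
  then have "X1 \<in> hull_verts C Xs" using Xs(2) by (auto simp: hull_verts_def)
  then have card0: "0 < card (hull_verts C Xs)" using fin by (auto simp: card_gt_0_iff)
  \<comment> \<open>The covector realising the edge is supported inside \<open>u\<close>, so every
    cocircuit below it is already an atom of \<open>L'\<close>, and no further cocircuit of
    \<open>C\<close> appears below it.\<close>
  have adj: "cocircuit_adj C a b" if ab: "a \<in> C" "b \<in> C" "S.edge (sign_at a) (sign_at b)" for a b
  proof -
    obtain Z where Z: "Z \<in> L'" "{w \<in> S.atoms. sle w Z} = {sign_at a, sign_at b}"
      and ne: "sign_at a \<noteq> sign_at b" using ab(3) by (auto simp: S.edge_def)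
    obtain z where z: "z \<in> covectors C" "Z = sign_at z" using Z(1) by (auto simp: L'_def Leq)
    have "{w \<in> C. le_top (Elem w) (Elem z)} = {a, b}"
    proof -
      have "le_ss w z \<longleftrightarrow> w \<in> {a, b}" if w: "w \<in> C" for w
      proof -
        have "le_ss w z \<longleftrightarrow> sle (sign_at w) Z"
          using le_ss_iff[OF covector_disj[OF z(1)] disj[OF w]] z(2) by simp
        also have "\<dots> \<longleftrightarrow> sign_at w \<in> {w \<in> S.atoms. sle w Z}"
          using w Z(1) sle_ssupp full unfolding S_atoms by blast
        also have "\<dots> \<longleftrightarrow> w \<in> {a, b}"
          unfolding Z(2) using inj_on_eq_iff[OF inj] w ab(1,2) by auto
        finally show ?thesis .
      qed
      then show ?thesis using ab(1,2) by auto
    qed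
    moreover have "Elem z \<in> covectors_top C" using z(1) covectors_top_cases by metis
    ultimately show ?thesis using ab ne unfolding cocircuit_adj_def by blast
  qed
  have conn: "Digraph_Component.connected (crabbed_hull C Xs \<restriction> (verts (crabbed_hull C Xs) - T))"
    if T: "T \<subseteq> verts (crabbed_hull C Xs)" "card T < h - 1" for T
  proof -
    let ?V = "hull_verts C Xs"
    have T': "T \<subseteq> ?V" using T(1) by (simp add: verts_crabbed_hull)
    then have "card T < card ?V" using T(2) card by simp
    then have ne: "?V - T \<noteq> {}" using card_mono[of T ?V] fin T' by (metis Diff_eq_empty_iff finite_subset leD)
    have img: "sign_at ` ?V - sign_at ` T = sign_at ` (?V - T)"
      by (rule inj_on_image_set_diff[OF inj, symmetric]) (use HC T' in blast)+
    have "(\<lambda>a b. a \<in> ?V - T \<and> b \<in> ?V - T \<and> cocircuit_adj C a b)\<^sup>*\<^sup>* x y"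
      if xy: "x \<in> ?V - T" "y \<in> ?V - T" for x y
    proof -
      have "card (sign_at ` T) + 2 \<le> h"
        using card_image_le[of T sign_at] T(2) finite_subset[OF T' fin] by simp
      then have "(S.edge_in (S.cone_atoms A - sign_at ` T))\<^sup>*\<^sup>* (sign_at x) (sign_at y)"
        using cone_connected[OF S.covector_system_axioms uL' cone_u full rank, of "sign_at ` T"] T' xy
        unfolding cone img by blast
      moreover have "\<exists>z\<in>?V - T. sign_at z = w \<and>
          (\<lambda>a b. a \<in> ?V - T \<and> b \<in> ?V - T \<and> cocircuit_adj C a b)\<^sup>*\<^sup>* x z"
        if "(S.edge_in (S.cone_atoms A - sign_at ` T))\<^sup>*\<^sup>* (sign_at x) w" for w
        using that
      proof (induction rule: rtranclp_induct)
        case base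
        then show ?case using xy(1) by blast
      next
        case (step w w')
        obtain z where z: "z \<in> ?V - T" "sign_at z = w"
          "(\<lambda>a b. a \<in> ?V - T \<and> b \<in> ?V - T \<and> cocircuit_adj C a b)\<^sup>*\<^sup>* x z"
          using step.IH by blast
        have "w' \<in> sign_at ` (?V - T)" using step.hyps(2) unfolding S.edge_in_def cone img by blast
        then obtain z' where z': "z' \<in> ?V - T" "w' = sign_at z'" by blast
        have "S.edge (sign_at z) (sign_at z')" using step.hyps(2) z(2) z'(2) by (simp add: S.edge_in_def)
        then have "cocircuit_adj C z z'" using adj z(1) z'(1) HC by blast
        then show ?case using z z' by (intro bexI[of _ z'] conjI rtranclp.rtrancl_into_rtrancl[OF z(3)]) auto
      qed
      ultimately obtain z where z: "z \<in> ?V - T" "sign_at z = sign_at y"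
          "(\<lambda>a b. a \<in> ?V - T \<and> b \<in> ?V - T \<and> cocircuit_adj C a b)\<^sup>*\<^sup>* x z" by blast
      then have "z = y" using inj_on_eq_iff[OF inj, of z y] xy(2) HC by blast
      then show ?thesis using z(3) by simp
    qed
    then show ?thesis
      unfolding verts_crabbed_hull induce_crabbed_hull[OF Diff_subset]
      using connected_induce_cocircuit_graph[OF _ ne] HC by blast
  qed
  show ?thesis
    unfolding m_connected_def using fin card card0 conn
    by (auto simp: verts_crabbed_hull h_def u_def)
qed

text \<open>The chain from zero through X to X o Y is strict when X is neither Y nor
  \<open>opp Y\<close>, so the height is at least 2. The hull is then at least 1-connected, and
  deleting the empty set shows that it is connected.\<close>

lemma m_connected_imp_crabbed_path:
  assumes conn: "\<forall>Xs. Xs \<noteq> [] \<and> set Xs \<subseteq> C \<longrightarrow>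
      m_connected (height C (comp_list Xs) - 1) (crabbed_hull C Xs)"
    and XY: "X \<in> C" "Y \<in> C" "X \<noteq> Y" "X \<noteq> opp Y"
  shows "\<exists>p. crabbed_path C X p Y"
proof -
  let ?u = "comp_list [X, Y]" and ?V = "hull_verts C [X, Y]"
  have u: "?u \<in> covectors C" using XY unfolding covectors_def by (intro CollectI exI[of _ "[X, Y]"]) simp
  have su: "sign_at ?u = scirc (sign_at X) (sign_at Y)"
    using sign_at_comp_list_append[of "[X]" "[Y]"] XY(1,2)
    by (simp add: comp_list_simps comp_ss_def empty_ss_def)
  have "le_ss X ?u"
    using le_ss_iff[OF covector_disj[OF u] disj[OF XY(1)]] su by simp
  moreover have "X \<noteq> ?u"
  proof
    assume "X = ?u"
    then have "sign_at X = scirc (sign_at X) (sign_at Y)" using su by metis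
    then have "ssupp (sign_at Y) \<subseteq> ssupp (sign_at X)" by (metis mem_ssupp scirc_apply subsetI)
    then have "Y = X \<or> Y = opp X" using incomparable[OF XY(2,1)] by (simp add: ssupp_sign_at)
    then show False using XY(3,4) by (auto simp: opp_def)
  qed
  moreover have "le_ss empty_ss X" by (simp add: le_ss_def separator_def supp_def empty_ss_def)
  moreover have "empty_ss \<noteq> X" using no_empty XY(1) by blast
  ultimately have "top_chain C ?u 2 (\<lambda>i. if i = 0 then Elem empty_ss else if i = 1 then Elem X else Elem ?u)"
    using u C_covector[OF XY(1)] empty_covector
    by (auto simp: top_chain_def covectors_top_cases lt_top_def numeral_2_eq_2 less_Suc_eq le_Suc_eq)
  then have h: "2 \<le> height C ?u" by (rule height_ge)
  have "m_connected (height C ?u - 1) (crabbed_hull C [X, Y])" using conn XY(1,2) by simp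
  then have "Digraph_Component.connected (crabbed_hull C [X, Y] \<restriction> (verts (crabbed_hull C [X, Y]) - {}))"
    using h unfolding m_connected_def by fastforce
  then have "Digraph_Component.connected (cocircuit_graph C \<restriction> ?V)"
    using induce_crabbed_hull[of ?V C "[X, Y]"] by (simp add: verts_crabbed_hull)
  moreover have XV: "X \<in> ?V" "Y \<in> ?V" "?V \<subseteq> C" using XY by (auto simp: hull_verts_def)
  ultimately have "(\<lambda>a b. a \<in> ?V \<and> b \<in> ?V \<and> cocircuit_adj C a b)\<^sup>*\<^sup>* X Y"
    using connected_induce_cocircuit_graph[of ?V C] by blast
  then show ?thesis using crabbed_path_iff[OF finite_C XY(1,2)] by blast
qed

end

theorem theorem3p3:
  fixes E :: "'a set" and C :: "'a signed_set set"
  assumes "finite E"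
    and "\<forall>X\<in>C. signed_set_on E X"
    and C0: "empty_ss \<notin> C"
    and C1: "C = opp ` C"
    and C2: "\<forall>X\<in>C. \<forall>Y\<in>C. supp X \<subseteq> supp Y \<longrightarrow> X = Y \<or> X = opp Y"
  shows "(oriented_matroid E C \<longleftrightarrow>
           (\<forall>Xs. Xs \<noteq> [] \<and> set Xs \<subseteq> C \<longrightarrow>
              m_connected (height C (comp_list Xs) - 1) (crabbed_hull C Xs))) \<and>
         (oriented_matroid E C \<longleftrightarrow>
           (\<forall>X\<in>C. \<forall>Y\<in>C. X \<noteq> Y \<and> X \<noteq> opp Y \<longrightarrow> (\<exists>p. crabbed_path C X p Y)))"
proof -
  interpret signed_system E C using assms by unfold_locales blast+
  show ?thesis
    using oriented_matroid_imp_m_connected m_connected_imp_crabbed_path crabbed_paths_imp_oriented_matroid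
    by blast
qed

end
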